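(* For every $c>0$ there exists $K_c>0$ such that for every $n$ the following holds. If $\mathcal{A}\subset S_n$ has no singleton intersection and $|\mathcal{A}|\ge c(n-2)!$, then there exist $i,j,k,l\in[n]$ with $i\ne k$, $j\ne l$ such that $$|\mathcal{A}\setminus\mathcal{A}_{i\mapsto j,k\mapsto l}|\le K_c(n-3)!.$$
   Context: $\mathcal{A}\subset S_n$ has no singleton intersection if no two permutations in $\mathcal{A}$ agree at exactly one point, i.e. there are no $\sigma,\tau\in\mathcal{A}$ with $\#\{i:\sigma(i)=\tau(i)\}=1$. For distinct $i_1,\dots,i_l$ and distinct $j_1,\dots,j_l$, $\mathcal{A}_{i_1\mapsto j_1,\dots,i_l\mapsto j_l}=\{\sigma\in\mathcal{A}:\sigma(i_k)=j_k\ \forall k\}$. *)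

theory Defs
  imports Complex_Main "HOL-Combinatorics.Permutations"
begin

definition Sym :: "nat \<Rightarrow> (nat \<Rightarrow> nat) set" where
  "Sym n = {\<sigma>. \<sigma> permutes {1..n}}"

definition no_singleton_intersection :: "nat \<Rightarrow> (nat \<Rightarrow> nat) set \<Rightarrow> bool" where
  "no_singleton_intersection n A \<longleftrightarrow>
     (\<forall>\<sigma>\<in>A. \<forall>\<tau>\<in>A. \<sigma> \<noteq> \<tau> \<longrightarrow> card {i\<in>{1..n}. \<sigma> i = \<tau> i} \<noteq> 1)"

definition fixing :: "(nat \<Rightarrow> nat) set \<Rightarrow> (nat \<times> nat) list \<Rightarrow> (nat \<Rightarrow> nat) set" where
  "fixing A ps = {\<sigma>\<in>A. \<forall>(i,j)\<in>set ps. \<sigma> i = j}"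

end

theory Submission
  imports Defs "HOL-Real_Asymp.Real_Asymp"
begin

text \<open>
  View a permutation as its graph in the grid \<open>{1..n} \<times> {1..n}\<close>, and call a family of sets \<open>R\<close>-spread
  if every set \<open>Y\<close> lies in at most a fraction \<open>R ^ - card Y\<close> of its members. Let \<open>S\<close> consist of the small
  partial permutations \<open>X\<close> above which \<open>A\<close> contains a large \<open>n powr (4 / 5)\<close>-spread subfamily. If more
  than \<open>fact (n - 3)\<close> members of \<open>A\<close> extended no element of \<open>S\<close>, a maximal \<open>X\<close> with many extensions among
  them would itself belong to \<open>S\<close>.

  A random half of the grid contains a member of a spread family with probability above 1/2, so two
  spread families above \<open>X\<close> and \<open>Y\<close> have members meeting in exactly \<open>X \<inter> Y\<close>. If \<open>X \<inter> Y\<close> is empty, one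
  first adds to \<open>X\<close> and \<open>Y\<close> a pair that is popular in both families; it exists because few
  permutations can lie almost entirely inside half of the grid. Hence, if no two members of \<open>A\<close> agree
  exactly once, any two elements of \<open>S\<close> share at least two pairs. Then either two pairs are common to all
  of \<open>S\<close>, and they define the required 2-star, or boundedly many triples of pairs cover \<open>S\<close>, so that \<open>A\<close>
  itself has size \<open>O(fact (n - 3))\<close>.
\<close>

section \<open>Spread families\<close>

text \<open>Members are indexed and counted with multiplicity, since distinct indices may receive
  the same set once fragments are taken.\<close>

definition spread :: "real \<Rightarrow> 'i set \<Rightarrow> ('i \<Rightarrow> 'a set) \<Rightarrow> bool" where
  "spread R I S \<longleftrightarrow> (\<forall>Y. finite Y \<longrightarrow> real (card {i\<in>I. Y \<subseteq> S i}) * R ^ card Y \<le> real (card I))"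

section \<open>Minimum fragments\<close>

text \<open>The minimum fragment known from proofs of the spread lemma. The member that attains it
  need not be \<open>S i\<close>; it only has to fit inside \<open>S i \<union> W\<close>.\<close>

definition frag :: "'i set \<Rightarrow> ('i \<Rightarrow> 'a set) \<Rightarrow> 'a set \<Rightarrow> 'i \<Rightarrow> 'a set" where
  "frag I S W i = S (arg_min (\<lambda>j. card (S j - W)) (\<lambda>j. j \<in> I \<and> S j \<subseteq> S i \<union> W)) - W"

lemma frag_props:
  assumes "i \<in> I"
  shows frag_witness: "\<exists>j\<in>I. S j - W = frag I S W i"
    and frag_subset: "frag I S W i \<subseteq> S i - W"
    and frag_minimal: "\<And>j. j \<in> I \<Longrightarrow> S j \<subseteq> S i \<union> W \<Longrightarrow> card (frag I S W i) \<le> card (S j - W)"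
proof -
  let ?P = "\<lambda>j. j \<in> I \<and> S j \<subseteq> S i \<union> W" and ?f = "\<lambda>j. card (S j - W)"
  have "?P i" using assms by auto
  note * = arg_min_nat_lemma[of ?P i ?f, OF this]
  show "\<exists>j\<in>I. S j - W = frag I S W i" "frag I S W i \<subseteq> S i - W"
    using * unfolding frag_def by blast+
  show "card (frag I S W i) \<le> card (S j - W)" if "j \<in> I" "S j \<subseteq> S i \<union> W" for j
    using * that unfolding frag_def by blast
qed

text \<open>Since the fragment is part of \<open>S i\<close>, the member \<open>S j\<close> competes
  in the minimisation for \<open>i\<close>. Its part outside \<open>W\<close> lies in the fragment
  and is at least as large, so the two coincide.\<close>

lemma frag_subset_of_covered:
  assumes "i \<in> I" "j \<in> I" "finite (S i)" "S j \<subseteq> W \<union> frag I S W i"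
  shows "frag I S W i \<subseteq> S j"
proof -
  have sub: "frag I S W i \<subseteq> S i - W" by (rule frag_subset) fact
  have "card (frag I S W i) \<le> card (S j - W)"
    using assms sub by (intro frag_minimal) auto
  moreover have "S j - W \<subseteq> frag I S W i" using assms by auto
  moreover have "finite (frag I S W i)" using sub assms finite_subset by blast
  ultimately have "S j - W = frag I S W i" by (meson card_seteq)
  then show ?thesis by auto
qed

text \<open>Expand a product of equal binomials over \<open>S\<close>. The second form normalises
  the weight \<open>z ^ card (S - T)\<close>: it describes a random \<open>T\<close> containing each
  point independently with probability \<open>1 / (1 + z)\<close>.\<close>

lemma sum_Pow_power_card:
  fixes z :: real
  assumes "finite S"
  shows "(\<Sum>T\<in>Pow S. z ^ card T) = (1 + z) ^ card S"
    and "(\<Sum>T\<in>Pow S. z ^ card (S - T)) = (1 + z) ^ card S"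
  using prod_add[OF assms, of "\<lambda>_. z" "\<lambda>_. 1"] prod_add[OF assms, of "\<lambda>_. 1" "\<lambda>_. z"]
  by (simp_all add: add.commute)

text \<open>The pair \<open>(W, i)\<close> is recovered from \<open>Z = W \<union> T\<close>, \<open>T\<close> and \<open>i\<close>, where \<open>T\<close> is the fragment. By
  minimality \<open>T\<close> lies in every member contained in \<open>Z\<close>, so once \<open>Z\<close> is known there are few
  choices for \<open>T\<close>, and spreadness leaves few choices for \<open>i\<close>.\<close>
lemma sum_frag_le:
  fixes R b :: real
  assumes "finite U" "finite I" "spread R I S" "R > 0" "b > 0"
    and SU: "\<And>i. i \<in> I \<Longrightarrow> S i \<subseteq> U" and Sk: "\<And>i. i \<in> I \<Longrightarrow> card (S i) \<le> k"
  shows "(\<Sum>W\<in>Pow U. b ^ card (U - W) * (\<Sum>i\<in>I. 2 ^ card (frag I S W i)))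
         \<le> (1 + b) ^ card U * card I * (1 + 2 * b / R) ^ k"
proof -
  \<comment> \<open>The representative depends on \<open>Z\<close> alone, so all fragments producing
    the same \<open>Z\<close> are subsets of one set of size at most \<open>k\<close>.\<close>
  define star where "star Z = S (SOME i. i \<in> I \<and> S i \<subseteq> Z)" for Z
  define D where "D = {Z\<in>Pow U. \<exists>i\<in>I. S i \<subseteq> Z}"
  have star: "\<exists>i\<in>I. star Z = S i \<and> S i \<subseteq> Z" if "Z \<in> D" for Z
    using someI_ex[of "\<lambda>i. i \<in> I \<and> S i \<subseteq> Z"] that unfolding D_def star_def by blast
  have finS: "finite (S i)" if "i \<in> I" for i using SU[OF that] \<open>finite U\<close> finite_subset by blast
  define Tgt where "Tgt = (SIGMA Z:D. SIGMA T:Pow (star Z). {i\<in>I. T \<subseteq> S i})"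
  \<comment> \<open>As \<open>Z\<close> is the disjoint union of \<open>W\<close> and
    \<open>T\<close>, the factor \<open>b ^ card (U - W)\<close> splits into
    \<open>b ^ card (U - Z)\<close> and \<open>b ^ card T\<close>; the latter merges with
    \<open>2 ^ card T\<close>.\<close>
  define w where "w = (\<lambda>(Z, T, i::'b). b ^ card (U - Z) * (2 * b) ^ card (T::'a set))"
  define \<phi> where "\<phi> = (\<lambda>(W, i). (W \<union> frag I S W i, frag I S W i, i))"
  have finD: "finite D" using \<open>finite U\<close> unfolding D_def by auto
  have finstar: "finite (star Z)" if "Z \<in> D" for Z using star[OF that] finS by fastforce
  have inj: "inj_on \<phi> (Pow U \<times> I)"
  proof (rule inj_onI, clarify)
    fix W i W' i' assume a: "W \<subseteq> U" "i \<in> I" "W' \<subseteq> U" "i' \<in> I" "\<phi> (W, i) = \<phi> (W', i')"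
    then have "i = i'" "frag I S W i = frag I S W' i" "W \<union> frag I S W i = W' \<union> frag I S W' i"
      by (auto simp: \<phi>_def)
    then show "W = W' \<and> i = i'"
      using frag_subset[OF a(2), of S W] frag_subset[OF a(2), of S W'] by blast
  qed
  have img: "\<phi> ` (Pow U \<times> I) \<subseteq> Tgt"
  proof (rule image_subsetI, clarify)
    fix W i assume a: "W \<subseteq> U" "i \<in> I"
    let ?T = "frag I S W i" let ?Z = "W \<union> ?T"
    have 1: "?T \<subseteq> S i - W" by (rule frag_subset) fact
    obtain j where j: "j \<in> I" "S j - W = ?T" using frag_witness[OF a(2), of S W] by blast
    have "?Z \<subseteq> U" using a 1 SU[OF a(2)] by auto
    moreover have "S j \<subseteq> ?Z" using j(2) by auto
    ultimately have ZD: "?Z \<in> D" using j(1) unfolding D_def by auto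
    from star[OF this] obtain j' where j': "j' \<in> I" "star ?Z = S j'" "S j' \<subseteq> ?Z" by auto
    have "?T \<subseteq> S j'"
      by (rule frag_subset_of_covered[where S = S and W = W, OF a(2) j'(1) finS[OF a(2)] j'(3)])
    then have "?T \<subseteq> star ?Z" using j'(2) by simp
    then show "\<phi> (W, i) \<in> Tgt" using ZD a(2) 1 by (auto simp: Tgt_def \<phi>_def)
  qed
  have wphi: "w (\<phi> (W, i)) = b ^ card (U - W) * 2 ^ card (frag I S W i)" if "W \<subseteq> U" "i \<in> I" for W i
  proof -
    let ?T = "frag I S W i"
    have T: "?T \<subseteq> U - W" using frag_subset[OF that(2), of S W] SU that by blast
    then have "U - W = (U - (W \<union> ?T)) \<union> ?T" by blast
    moreover have "card ((U - (W \<union> ?T)) \<union> ?T) = card (U - (W \<union> ?T)) + card ?T"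
      using T \<open>finite U\<close> finite_subset by (intro card_Un_disjoint) blast+
    ultimately have "card (U - W) = card (U - (W \<union> ?T)) + card ?T" by simp
    then show ?thesis by (simp add: w_def \<phi>_def power_add power_mult_distrib)
  qed
  have "(\<Sum>W\<in>Pow U. b ^ card (U - W) * (\<Sum>i\<in>I. 2 ^ card (frag I S W i)))
      = (\<Sum>W\<in>Pow U. \<Sum>i\<in>I. w (\<phi> (W, i)))"
    by (simp add: sum_distrib_left wphi)
  also have "\<dots> = (\<Sum>(W, i)\<in>Pow U \<times> I. w (\<phi> (W, i)))"
    by (rule sum.cartesian_product)
  also have "\<dots> = sum w (\<phi> ` (Pow U \<times> I))"
    by (subst sum.reindex[OF inj]) (simp add: case_prod_unfold comp_def)
  also have "\<dots> \<le> sum w Tgt"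
    using img finD finstar \<open>finite I\<close> \<open>b > 0\<close>
    by (intro sum_mono2) (auto simp: Tgt_def w_def)
  also have "\<dots> = (\<Sum>Z\<in>D. b ^ card (U - Z) * (\<Sum>T\<in>Pow (star Z). (2 * b) ^ card T * card {i\<in>I. T \<subseteq> S i}))"
    unfolding Tgt_def w_def using finD finstar \<open>finite I\<close>
    by (subst sum.Sigma[symmetric]) (auto simp: sum.Sigma[symmetric] sum_distrib_left mult_ac intro!: sum.cong)
  also have "\<dots> \<le> (\<Sum>Z\<in>D. b ^ card (U - Z) * (card I * (1 + 2 * b / R) ^ k))"
  proof (intro sum_mono mult_left_mono)
    fix Z assume Z: "Z \<in> D"
    \<comment> \<open>Spreadness leaves at most \<open>card I / R ^ card T\<close> choices of
      \<open>i\<close> for each \<open>T\<close>; the sum over subsets of \<open>star Z\<close> is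
      then a binomial expansion.\<close>
    have "(\<Sum>T\<in>Pow (star Z). (2 * b) ^ card T * card {i\<in>I. T \<subseteq> S i})
        \<le> (\<Sum>T\<in>Pow (star Z). card I * (2 * b / R) ^ card T)"
    proof (rule sum_mono)
      fix T assume "T \<in> Pow (star Z)"
      then have "finite T" using finstar[OF Z] finite_subset by blast
      then have "real (card {i\<in>I. T \<subseteq> S i}) * R ^ card T \<le> card I" using assms(3) unfolding spread_def by blast
      then have "real (card {i\<in>I. T \<subseteq> S i}) \<le> card I / R ^ card T" using \<open>R > 0\<close> by (simp add: field_simps)
      from mult_left_mono[OF this, of "(2 * b) ^ card T"]
      show "(2 * b) ^ card T * card {i\<in>I. T \<subseteq> S i} \<le> card I * (2 * b / R) ^ card T"
        using \<open>b > 0\<close> by (simp add: power_divide mult_ac)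
    qed
    also have "\<dots> = card I * (1 + 2 * b / R) ^ card (star Z)"
      using sum_Pow_power_card(1)[OF finstar[OF Z]] by (simp add: sum_distrib_left[symmetric])
    also have "\<dots> \<le> card I * (1 + 2 * b / R) ^ k"
      using star[OF Z] Sk \<open>b > 0\<close> \<open>R > 0\<close> by (intro mult_left_mono power_increasing) auto
    finally show "(\<Sum>T\<in>Pow (star Z). (2 * b) ^ card T * card {i\<in>I. T \<subseteq> S i}) \<le> card I * (1 + 2 * b / R) ^ k" .
  qed (use \<open>b > 0\<close> in auto)
  also have "\<dots> \<le> (\<Sum>Z\<in>Pow U. b ^ card (U - Z) * (card I * (1 + 2 * b / R) ^ k))"
    using \<open>b > 0\<close> \<open>R > 0\<close> \<open>finite U\<close> by (intro sum_mono2) (auto simp: D_def)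
  also have "\<dots> = (1 + b) ^ card U * card I * (1 + 2 * b / R) ^ k"
    using sum_Pow_power_card(2)[OF \<open>finite U\<close>] by (simp add: sum_distrib_right[symmetric])
  finally show ?thesis .
qed

section \<open>Spread families and random halves of the ground set\<close>

lemma spread_antimono:
  assumes "spread R I S" "0 \<le> R'" "R' \<le> R"
  shows "spread R' I S"
  unfolding spread_def
proof (intro allI impI)
  fix Y :: "'b set" assume "finite Y"
  have "real (card {i\<in>I. Y \<subseteq> S i}) * R' ^ card Y \<le> card {i\<in>I. Y \<subseteq> S i} * R ^ card Y"
    using assms by (intro mult_left_mono power_mono) auto
  also have "\<dots> \<le> card I" using assms(1) \<open>finite Y\<close> unfolding spread_def by blast
  finally show "real (card {i\<in>I. Y \<subseteq> S i}) * R' ^ card Y \<le> card I" .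
qed

text \<open>Losing half of the indices costs a factor 2. Halving \<open>R\<close> gains
  \<open>2 ^ card Y\<close>, which pays for it as soon as \<open>Y\<close> is nonempty.\<close>

lemma spread_mono:
  assumes "finite I" "spread R I S" "I' \<subseteq> I" "card I \<le> 2 * card I'" "R \<ge> 0"
    and "\<And>i. i \<in> I' \<Longrightarrow> S' i \<subseteq> S i"
  shows "spread (R / 2) I' S'"
  unfolding spread_def
proof (intro allI impI)
  fix Y :: "'b set" assume Y: "finite Y"
  show "real (card {i\<in>I'. Y \<subseteq> S' i}) * (R / 2) ^ card Y \<le> real (card I')"
  proof (cases "Y = {}")
    case False
    have "card {i\<in>I'. Y \<subseteq> S' i} \<le> card {i\<in>I. Y \<subseteq> S i}"
      using assms by (intro card_mono) auto
    then have "real (card {i\<in>I'. Y \<subseteq> S' i}) * (R / 2) ^ card Y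
        \<le> real (card {i\<in>I. Y \<subseteq> S i}) * (R / 2) ^ card Y"
      using assms by (intro mult_right_mono) auto
    also have "\<dots> = (real (card {i\<in>I. Y \<subseteq> S i}) * R ^ card Y) / 2 ^ card Y"
      by (simp add: power_divide)
    also have "\<dots> \<le> real (card I) / 2 ^ card Y"
      using assms(2) Y unfolding spread_def by (intro divide_right_mono) auto
    also have "\<dots> \<le> real (card I) / 2 ^ 1"
      using False Y card_gt_0_iff[of Y] by (intro divide_left_mono power_increasing) auto
    also have "\<dots> \<le> real (card I')" using assms(4) by simp
    finally show ?thesis .
  qed simp
qed

text \<open>Two rounds of fragments: a random subset of density 1/4 reduces most members to
  fragments of size below \<open>t\<close>, and another random quarter swallows one of those fragments.\<close>
lemma spread_half:
  fixes R :: real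
  assumes "finite U" "finite I" "I \<noteq> {}" "spread R I S" "R > 0"
    and SU: "\<And>i. i \<in> I \<Longrightarrow> S i \<subseteq> U" and Sk: "\<And>i. i \<in> I \<Longrightarrow> card (S i) \<le> k"
    and t1: "16 * (1 + 6 / R) ^ k \<le> 2 ^ t" and t2: "(1 + 8 / R) ^ t \<le> 5 / 4"
  shows "2 * card {V\<in>Pow U. \<forall>i\<in>I. \<not> S i \<subseteq> V} < 2 ^ card U"
proof -
  define B where "B = {V\<in>Pow U. \<forall>i\<in>I. \<not> S i \<subseteq> V}"
  define G where "G W = {i\<in>I. card (frag I S W i) < t}" for W
  define bad where "bad W \<longleftrightarrow> card I > 2 * card (G W)" for W
  \<comment> \<open>Each point goes to \<open>W\<close>, \<open>V - W\<close> or
    \<open>U - V\<close> with weight 1, 1 or 2. Then every \<open>V\<close> gets the same total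
    weight \<open>2 ^ card U\<close>, \<open>W\<close> has density 1/4, and given \<open>W\<close>
    the set \<open>V - W\<close> has density 1/3 in \<open>U - W\<close>. These densities are the
    weights 3 and 2 in the two applications of the fragment bound.\<close>
  define h where "h W = (\<Sum>V\<in>{V\<in>B. W \<subseteq> V}. (2::real) ^ card (U - V))" for W
  have Ipos: "card I > 0" using assms by (simp add: card_gt_0_iff)
  have finB: "finite B" using \<open>finite U\<close> unfolding B_def by auto
  have "(\<Sum>W\<in>Pow U. 3 ^ card (U - W) * (\<Sum>i\<in>I. 2 ^ card (frag I S W i)))
      \<le> (1 + 3) ^ card U * real (card I) * (1 + 2 * 3 / R) ^ k"
    by (rule sum_frag_le) (use assms in auto)
  also have "\<dots> \<le> 4 ^ card U * real (card I) * (2 ^ t / 16)"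
    using t1 by (intro mult_mono) (use \<open>R > 0\<close> in auto)
  finally have 1: "(\<Sum>W\<in>Pow U. 3 ^ card (U - W) * (\<Sum>i\<in>I. 2 ^ card (frag I S W i)))
      \<le> 4 ^ card U * real (card I) * (2 ^ t / 16)" .
  \<comment> \<open>Markov's inequality in exponential form: for a bad \<open>W\<close>, at least
    half of the indices have fragments of size at least \<open>t\<close>.\<close>
  have badW: "2 ^ t * (card I / 2) \<le> (\<Sum>i\<in>I. (2::real) ^ card (frag I S W i))" if "bad W" for W
  proof -
    have "card I = card (G W) + card (I - G W)"
      using card_Diff_subset[of "G W" I] card_mono[of I "G W"] \<open>finite I\<close>
      by (auto simp: G_def finite_subset)
    then have "card I / 2 \<le> card (I - G W)" using that unfolding bad_def by linarith
    then have "2 ^ t * (card I / 2) \<le> (\<Sum>i\<in>I - G W. (2::real) ^ t)"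
      by (simp add: mult_ac)
    also have "\<dots> \<le> (\<Sum>i\<in>I - G W. 2 ^ card (frag I S W i))"
      by (intro sum_mono power_increasing) (auto simp: G_def)
    also have "\<dots> \<le> (\<Sum>i\<in>I. 2 ^ card (frag I S W i))"
      using \<open>finite I\<close> by (intro sum_mono2) auto
    finally show ?thesis .
  qed
  have "(\<Sum>W\<in>{W\<in>Pow U. bad W}. 3 ^ card (U - W)) * (2 ^ t * (card I / 2))
      = (\<Sum>W\<in>{W\<in>Pow U. bad W}. 3 ^ card (U - W) * (2 ^ t * (card I / 2)))"
    by (rule sum_distrib_right)
  also have "\<dots> \<le> (\<Sum>W\<in>{W\<in>Pow U. bad W}. 3 ^ card (U - W) * (\<Sum>i\<in>I. 2 ^ card (frag I S W i)))"
    by (intro sum_mono mult_left_mono badW) auto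
  also have "\<dots> \<le> (\<Sum>W\<in>Pow U. 3 ^ card (U - W) * (\<Sum>i\<in>I. 2 ^ card (frag I S W i)))"
    using \<open>finite U\<close> by (intro sum_mono2) (auto intro!: mult_nonneg_nonneg sum_nonneg)
  also have "\<dots> \<le> 4 ^ card U / 8 * (2 ^ t * (card I / 2))" using 1 by (simp add: mult_ac)
  finally have sumbad: "(\<Sum>W\<in>{W\<in>Pow U. bad W}. 3 ^ card (U - W)) \<le> (4::real) ^ card U / 8"
    by (rule mult_right_le_imp_le) (use Ipos in simp)
  have hsub: "h W = (\<Sum>V\<in>{V\<in>Pow (U - W). \<forall>i\<in>I. \<not> S i \<subseteq> W \<union> V}. 2 ^ card (U - W - V))"
    if "W \<subseteq> U" for W
    unfolding h_def
    by (rule sum.reindex_bij_witness[of _ "\<lambda>V. W \<union> V" "\<lambda>V. V - W"])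
      (use that in \<open>auto simp: B_def Un_absorb1 Diff_Diff_Int intro!: arg_cong[where f = card]\<close>)
  have hle: "h W \<le> 3 ^ card (U - W)" if "W \<subseteq> U" for W
  proof -
    have "h W \<le> (\<Sum>V\<in>Pow (U - W). 2 ^ card (U - W - V))"
      unfolding hsub[OF that] using \<open>finite U\<close> by (intro sum_mono2) auto
    then show ?thesis using sum_Pow_power_card(2)[of "U - W" 2] \<open>finite U\<close> by simp
  qed
  have hgood: "h W \<le> 3 ^ card (U - W) / 4" if W: "W \<subseteq> U" "\<not> bad W" for W
  proof -
    let ?S = "frag I S W" and ?I = "G W" and ?U = "U - W"
    have finI: "finite ?I" using \<open>finite I\<close> by (auto simp: G_def)
    have Ipos': "card ?I > 0" using W(2) Ipos unfolding bad_def by linarith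
    have sub: "?S i \<subseteq> S i - W" if "i \<in> ?I" for i
      by (rule frag_subset) (use that in \<open>simp add: G_def\<close>)
    \<comment> \<open>Second round: the short fragments are themselves a spread family, now with
      sets of size below \<open>t\<close> in place of \<open>k\<close>.\<close>
    have "spread (R / 2) ?I ?S"
      by (rule spread_mono[OF \<open>finite I\<close> assms(4)])
        (use W(2) \<open>R > 0\<close> sub in \<open>auto simp: bad_def G_def\<close>)
    then have "(\<Sum>V\<in>Pow ?U. 2 ^ card (?U - V) * (\<Sum>i\<in>?I. 2 ^ card (frag ?I ?S V i)))
        \<le> (1 + 2) ^ card ?U * real (card ?I) * (1 + 2 * 2 / (R / 2)) ^ t"
    proof (rule sum_frag_le[rotated 2])
      show "?S i \<subseteq> ?U" if "i \<in> ?I" for i using sub[OF that] SU[of i] that by (auto simp: G_def)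
    qed (use finI \<open>finite U\<close> \<open>R > 0\<close> in \<open>auto simp: G_def\<close>)
    also have "\<dots> \<le> 3 ^ card ?U * real (card ?I) * (5 / 4)"
      using t2 \<open>R > 0\<close> by (intro mult_mono) auto
    finally have 2: "(\<Sum>V\<in>Pow ?U. 2 ^ card (?U - V) * (\<Sum>i\<in>?I. 2 ^ card (frag ?I ?S V i)))
        \<le> 3 ^ card ?U * real (card ?I) * (5 / 4)" .
    define C where "C = {V\<in>Pow ?U. \<forall>i\<in>I. \<not> S i \<subseteq> W \<union> V}"
    \<comment> \<open>If \<open>W \<union> V\<close> contains no member, no second fragment is
      empty, so every term is at least 2 instead of 1. The excess over the trivial lower bound thus
      measures the weight of the failing \<open>V\<close>.\<close>
    have ge: "real (card ?I) * (1 + (if V \<in> C then 1 else 0)) \<le> (\<Sum>i\<in>?I. 2 ^ card (frag ?I ?S V i))"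
      if "V \<in> Pow ?U" for V
    proof -
      have "(if V \<in> C then 1 else 0) \<le> card (frag ?I ?S V i)" if i: "i \<in> ?I" for i
      proof (cases "V \<in> C")
        case True
        have "S i \<subseteq> U" using SU i by (simp add: G_def)
        then have "frag ?I ?S V i \<subseteq> U" using frag_subset[OF i, of ?S V] sub[OF i] by blast
        then have "finite (frag ?I ?S V i)" using \<open>finite U\<close> finite_subset by blast
        moreover have "frag ?I ?S V i \<noteq> {}"
        proof
          \<comment> \<open>An empty second fragment means that \<open>V\<close> covers some first
            fragment, and then \<open>W \<union> V\<close> covers the member it came from.\<close>
          assume e: "frag ?I ?S V i = {}"
          obtain j where j: "j \<in> ?I" "?S j - V = {}" using frag_witness[OF i, of ?S V] unfolding e by blast
          then obtain l where "l \<in> I" "S l - W = ?S j"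
            using frag_witness[of j I S W] j(1) unfolding G_def by blast
          then have "S l \<subseteq> W \<union> V" using j(2) by blast
          then show False using True \<open>l \<in> I\<close> by (simp add: C_def)
        qed
        ultimately show ?thesis using card_gt_0_iff[of "frag ?I ?S V i"] by simp
      qed simp
      then have "(\<Sum>i\<in>?I. (2::real) ^ (if V \<in> C then 1 else 0)) \<le> (\<Sum>i\<in>?I. 2 ^ card (frag ?I ?S V i))"
        by (intro sum_mono power_increasing) auto
      then show ?thesis by (simp split: if_splits)
    qed
    have "card ?I * (3 ^ card ?U + h W)
        = (\<Sum>V\<in>Pow ?U. 2 ^ card (?U - V) * (real (card ?I) * (1 + (if V \<in> C then 1 else 0))))"
    proof -
      have "h W = (\<Sum>V\<in>Pow ?U. if V \<in> C then 2 ^ card (?U - V) else 0)"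
        unfolding hsub[OF W(1)] using \<open>finite U\<close>
        by (subst sum.inter_filter[symmetric]) (auto simp: C_def intro!: sum.cong)
      moreover have "(\<Sum>V\<in>Pow ?U. (2::real) ^ card (?U - V)) = 3 ^ card ?U"
        using sum_Pow_power_card(2)[of ?U 2] \<open>finite U\<close> by simp
      moreover have "(\<Sum>V\<in>Pow ?U. (2::real) ^ card (?U - V) * (1 + (if V \<in> C then 1 else 0)))
          = (\<Sum>V\<in>Pow ?U. 2 ^ card (?U - V) + (if V \<in> C then 2 ^ card (?U - V) else 0))"
        by (intro sum.cong) auto
      ultimately have "(\<Sum>V\<in>Pow ?U. 2 ^ card (?U - V) * (1 + (if V \<in> C then 1 else 0)))
          = 3 ^ card ?U + h W"
        by (simp only: sum.distrib)
      from arg_cong[OF this, of "\<lambda>x. real (card ?I) * x"]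
      show ?thesis by (simp only: sum_distrib_left mult.left_commute)
    qed
    also have "\<dots> \<le> (\<Sum>V\<in>Pow ?U. 2 ^ card (?U - V) * (\<Sum>i\<in>?I. 2 ^ card (frag ?I ?S V i)))"
      by (intro sum_mono mult_left_mono ge) auto
    also have "\<dots> \<le> card ?I * (3 ^ card ?U * (5 / 4))" using 2 by (simp add: mult_ac)
    finally have "3 ^ card ?U + h W \<le> 3 ^ card ?U * (5 / 4)"
      by (rule mult_left_le_imp_le) (use Ipos' in simp)
    then show ?thesis by simp
  qed
  have "real (card B) * 2 ^ card U = (\<Sum>V\<in>B. \<Sum>W\<in>Pow V. 2 ^ card (U - V))"
  proof -
    have "(\<Sum>W\<in>Pow V. (2::real) ^ card (U - V)) = 2 ^ card U" if "V \<in> B" for V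
    proof -
      have V: "V \<subseteq> U" "finite V" using that \<open>finite U\<close> finite_subset by (auto simp: B_def)
      then have "card U = card V + card (U - V)"
        using \<open>finite U\<close> by (simp add: card_Diff_subset card_mono)
      then show ?thesis using V by (simp add: card_Pow power_add)
    qed
    then show ?thesis by simp
  qed
  also have "\<dots> = (\<Sum>V\<in>B. \<Sum>W\<in>{W\<in>Pow U. W \<subseteq> V}. 2 ^ card (U - V))"
    by (intro sum.cong) (auto simp: B_def)
  also have "\<dots> = (\<Sum>W\<in>Pow U. h W)"
    unfolding h_def using finB \<open>finite U\<close> by (subst sum.swap_restrict) auto
  \<comment> \<open>A good \<open>W\<close> fails with conditional probability at most 1/4 and the
    bad ones have probability at most 1/8, which gives 3/8 in total.\<close>
  also have "\<dots> \<le> (\<Sum>W\<in>Pow U. 3 ^ card (U - W) / 4 + (if bad W then 3 ^ card (U - W) else 0))"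
  proof (rule sum_mono)
    fix W assume "W \<in> Pow U"
    then show "h W \<le> 3 ^ card (U - W) / 4 + (if bad W then 3 ^ card (U - W) else 0)"
      using add_increasing[OF _ hle[of W], of "3 ^ card (U - W) / 4"] hgood[of W] by (cases "bad W") auto
  qed
  also have "\<dots> = 4 ^ card U / 4 + (\<Sum>W\<in>{W\<in>Pow U. bad W}. 3 ^ card (U - W))"
  proof -
    have "(\<Sum>W\<in>{W\<in>Pow U. bad W}. (3::real) ^ card (U - W))
        = (\<Sum>W\<in>Pow U. if bad W then 3 ^ card (U - W) else 0)"
      using \<open>finite U\<close> by (intro sum.inter_filter) simp
    then show ?thesis
      using sum_Pow_power_card(2)[OF \<open>finite U\<close>, of 3]
      by (simp only: sum.distrib sum_divide_distrib[symmetric]) simp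
  qed
  also have "\<dots> \<le> 4 ^ card U / 4 + 4 ^ card U / 8" using sumbad by simp
  also have "\<dots> = (3 / 8 * 2 ^ card U) * 2 ^ card U"
    by (simp add: power_mult_distrib[symmetric])
  finally have "real (card B) \<le> 3 / 8 * 2 ^ card U"
    by (rule mult_right_le_imp_le) simp
  then have "real (2 * card B) < real (2 ^ card U)" by (simp add: field_simps) (smt (verit) zero_less_power)
  then show ?thesis unfolding B_def by (simp only: of_nat_less_iff)
qed

text \<open>A uniform random \<open>V\<close> contains a member of the first family with probability
  above 1/2, and so does its complement for the second. Some \<open>V\<close> achieves both.\<close>

lemma spread_disjoint_members:
  fixes R :: real
  assumes "finite U" "R > 0"
    and I: "finite I" "I \<noteq> {}" "spread R I S" "\<And>i. i \<in> I \<Longrightarrow> S i \<subseteq> U" "\<And>i. i \<in> I \<Longrightarrow> card (S i) \<le> k"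
    and J: "finite J" "J \<noteq> {}" "spread R J T" "\<And>j. j \<in> J \<Longrightarrow> T j \<subseteq> U" "\<And>j. j \<in> J \<Longrightarrow> card (T j) \<le> k"
    and t: "16 * (1 + 6 / R) ^ k \<le> 2 ^ t" "(1 + 8 / R) ^ t \<le> 5 / 4"
  shows "\<exists>i\<in>I. \<exists>j\<in>J. S i \<inter> T j = {}"
proof -
  define B where "B = {V\<in>Pow U. \<forall>i\<in>I. \<not> S i \<subseteq> V}"
  define C where "C = {V\<in>Pow U. \<forall>j\<in>J. \<not> T j \<subseteq> V}"
  have "2 * card B < 2 ^ card U" unfolding B_def
    by (rule spread_half[OF \<open>finite U\<close> I(1-3) \<open>R > 0\<close> I(4,5) t])
  moreover have "2 * card C < 2 ^ card U" unfolding C_def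
    by (rule spread_half[OF \<open>finite U\<close> J(1-3) \<open>R > 0\<close> J(4,5) t])
  moreover have "card ((\<lambda>V. U - V) ` C) \<le> card C"
    by (rule card_image_le) (use \<open>finite U\<close> in \<open>simp add: C_def\<close>)
  ultimately have "card (B \<union> (\<lambda>V. U - V) ` C) < card (Pow U)"
    using card_Un_le[of B "(\<lambda>V. U - V) ` C"] \<open>finite U\<close> by (simp add: card_Pow)
  moreover have "finite (B \<union> (\<lambda>V. U - V) ` C)" using \<open>finite U\<close> by (simp add: B_def C_def)
  ultimately have "\<not> Pow U \<subseteq> B \<union> (\<lambda>V. U - V) ` C"
    using card_mono[of "B \<union> (\<lambda>V. U - V) ` C" "Pow U"] by linarith
  then obtain V where V: "V \<subseteq> U" "V \<notin> B" "V \<notin> (\<lambda>V. U - V) ` C" by blast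
  have "U - V \<notin> C" using V double_diff[of V U U] by (metis image_eqI order_refl)
  with V show ?thesis by (fastforce simp: B_def C_def)
qed

section \<open>Permutations as sets of pairs\<close>

definition pairs :: "nat \<Rightarrow> (nat \<Rightarrow> nat) \<Rightarrow> (nat \<times> nat) set" where
  "pairs n \<sigma> = (\<lambda>i. (i, \<sigma> i)) ` {1..n}"

lemma pairs_iff: "(i, j) \<in> pairs n \<sigma> \<longleftrightarrow> i \<in> {1..n} \<and> \<sigma> i = j"
  by (auto simp: pairs_def)

lemma finite_pairs [simp]: "finite (pairs n \<sigma>)"
  by (simp add: pairs_def)

lemma card_pairs [simp]: "card (pairs n \<sigma>) = n"
  by (simp add: pairs_def card_image inj_on_def)

lemma pairs_subset_grid: "\<sigma> \<in> Sym n \<Longrightarrow> pairs n \<sigma> \<subseteq> {1..n} \<times> {1..n}"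
  using permutes_in_image[of \<sigma> "{1..n}"] by (auto simp: pairs_def Sym_def simp del: One_nat_def)

lemma card_agreements: "card {i\<in>{1..n}. \<sigma> i = \<tau> i} = card (pairs n \<sigma> \<inter> pairs n \<tau>)"
proof -
  have "pairs n \<sigma> \<inter> pairs n \<tau> = (\<lambda>i. (i, \<sigma> i)) ` {i\<in>{1..n}. \<sigma> i = \<tau> i}"
    by (auto simp: pairs_def)
  then show ?thesis by (simp add: card_image inj_on_def)
qed

lemma finite_Sym: "finite (Sym n)"
  by (simp add: Sym_def finite_permutations)

lemma card_Sym: "card (Sym n) = fact n"
  by (simp add: Sym_def card_permutations)

text \<open>Composing with the inverse of one fixed permutation through \<open>Y\<close> turns all
  of them into permutations fixing the first coordinates of \<open>Y\<close>.\<close>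

lemma card_Sym_containing:
  "card {\<sigma>\<in>Sym n. Y \<subseteq> pairs n \<sigma>} \<le> fact (n - card Y)"
proof (cases "{\<sigma>\<in>Sym n. Y \<subseteq> pairs n \<sigma>} = {}")
  case False
  then obtain \<rho> where \<rho>: "\<rho> permutes {1..n}" "Y \<subseteq> pairs n \<rho>" by (auto simp: Sym_def)
  define D where "D = fst ` Y"
  have Y: "Y = (\<lambda>i. (i, \<rho> i)) ` D" and D: "D \<subseteq> {1..n}"
    using \<rho>(2) by (force simp: D_def pairs_def image_iff)+
  have "card Y = card D" unfolding Y by (simp add: card_image inj_on_def)
  have "(\<lambda>\<sigma>. inv \<rho> \<circ> \<sigma>) ` {\<sigma>\<in>Sym n. Y \<subseteq> pairs n \<sigma>} \<subseteq> {p. p permutes ({1..n} - D)}"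
  proof (rule image_subsetI, clarify)
    fix \<sigma> assume s: "\<sigma> \<in> Sym n" "Y \<subseteq> pairs n \<sigma>"
    have "inv \<rho> \<circ> \<sigma> permutes {1..n}"
      using s(1) \<rho>(1) by (intro permutes_compose permutes_inv) (auto simp: Sym_def)
    moreover have "(inv \<rho> \<circ> \<sigma>) i = i" if "i \<in> D" for i
    proof -
      have "\<sigma> i = \<rho> i" using s(2) that unfolding Y by (auto simp: pairs_def)
      then show ?thesis using permutes_inverses(2)[OF \<rho>(1)] by simp
    qed
    ultimately show "inv \<rho> \<circ> \<sigma> permutes {1..n} - D"
      by (rule permutes_superset) auto
  qed
  moreover have "inj_on (\<lambda>\<sigma>. inv \<rho> \<circ> \<sigma>) {\<sigma>\<in>Sym n. Y \<subseteq> pairs n \<sigma>}"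
  proof (rule inj_onI)
    fix \<sigma> \<tau> :: "nat \<Rightarrow> nat" assume "inv \<rho> \<circ> \<sigma> = inv \<rho> \<circ> \<tau>"
    then have "\<rho> \<circ> (inv \<rho> \<circ> \<sigma>) = \<rho> \<circ> (inv \<rho> \<circ> \<tau>)" by simp
    then show "\<sigma> = \<tau>" by (simp add: o_assoc permutes_inv_o(1)[OF \<rho>(1)])
  qed
  moreover have "finite {p. p permutes ({1..n} - D)}" by (simp add: finite_permutations)
  ultimately have "card {\<sigma>\<in>Sym n. Y \<subseteq> pairs n \<sigma>} \<le> card {p. p permutes ({1..n} - D)}"
    by (intro card_inj_on_le)
  also have "\<dots> = fact (card ({1..n} - D))" by (rule card_permutations) auto
  also have "card ({1..n} - D) = n - card Y"
    using D \<open>card Y = card D\<close> finite_subset[OF D] by (simp add: card_Diff_subset)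
  finally show ?thesis .
qed (simp del: Collect_empty_eq)

section \<open>Spread families of permutations\<close>

text \<open>Union bound: each point of \<open>Z\<close> lies in at most a fraction
  \<open>1 / R\<close> of the members.\<close>

lemma spread_avoid:
  assumes "finite I" "spread R I S" "finite Z" "2 * real (card Z) \<le> R" "R > 0"
  shows "card I \<le> 2 * card {i\<in>I. S i \<inter> Z = {}}"
proof -
  let ?G = "{i\<in>I. S i \<inter> Z = {}}"
  have "card {i\<in>I. {z} \<subseteq> S i} * R ^ card {z} \<le> card I" for z
    using assms(2) unfolding spread_def by blast
  then have z: "real (card {i\<in>I. z \<in> S i}) \<le> card I / R" for z
    using \<open>R > 0\<close> by (simp add: field_simps)
  have "card I \<le> card (?G \<union> (\<Union>z\<in>Z. {i\<in>I. z \<in> S i}))"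
    using assms by (intro card_mono) auto
  also have "\<dots> \<le> card ?G + (\<Sum>z\<in>Z. card {i\<in>I. z \<in> S i})"
    using card_Un_le card_UN_le[OF \<open>finite Z\<close>, of "\<lambda>z. {i\<in>I. z \<in> S i}"] by (meson add_left_mono le_trans)
  finally have "real (card I) \<le> real (card ?G + (\<Sum>z\<in>Z. card {i\<in>I. z \<in> S i}))"
    by (rule of_nat_mono)
  also have "\<dots> = card ?G + (\<Sum>z\<in>Z. real (card {i\<in>I. z \<in> S i}))" by simp
  also have "\<dots> \<le> card ?G + (\<Sum>z\<in>Z. card I / R)" by (intro add_left_mono sum_mono z)
  also have "\<dots> = card ?G + card I / 2 * (2 * card Z / R)" by simp
  also have "\<dots> \<le> card ?G + card I / 2 * 1"
    using assms by (intro add_left_mono mult_left_mono) auto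
  finally show ?thesis by simp
qed

text \<open>First discard the permutations in \<open>F\<close> that meet \<open>Y - X\<close> and
  those in \<open>G\<close> that meet \<open>X - Y\<close>; at least half of each family survives.
  For the survivors, disjointness outside \<open>X\<close> and \<open>Y\<close> makes the
  intersection exactly \<open>X \<inter> Y\<close>. The constants 12 and 16 are 6 and 8 doubled, as
  \<open>R\<close> is halved.\<close>

lemma exists_meeting_exactly:
  fixes R :: real
  assumes F: "F \<subseteq> Sym n" "F \<noteq> {}" "spread R F (\<lambda>\<sigma>. pairs n \<sigma> - X)" "\<And>\<sigma>. \<sigma> \<in> F \<Longrightarrow> X \<subseteq> pairs n \<sigma>"
    and G: "G \<subseteq> Sym n" "G \<noteq> {}" "spread R G (\<lambda>\<sigma>. pairs n \<sigma> - Y)" "\<And>\<sigma>. \<sigma> \<in> G \<Longrightarrow> Y \<subseteq> pairs n \<sigma>"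
    and q: "2 * real (card X) \<le> R" "2 * real (card Y) \<le> R" "R > 0"
    and t: "16 * (1 + 12 / R) ^ n \<le> 2 ^ t" "(1 + 16 / R) ^ t \<le> 5 / 4"
  shows "\<exists>\<sigma>\<in>F. \<exists>\<tau>\<in>G. pairs n \<sigma> \<inter> pairs n \<tau> = X \<inter> Y"
proof -
  have fin: "finite F" "finite G" using F(1) G(1) finite_Sym finite_subset by blast+
  have "finite X" "finite Y" using F(2,4) G(2,4) finite_pairs finite_subset by (meson ex_in_conv)+
  define F' where "F' = {\<sigma>\<in>F. (pairs n \<sigma> - X) \<inter> (Y - X) = {}}"
  define G' where "G' = {\<sigma>\<in>G. (pairs n \<sigma> - Y) \<inter> (X - Y) = {}}"
  have YX: "card (Y - X) \<le> card Y" "card (X - Y) \<le> card X"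
    using \<open>finite X\<close> \<open>finite Y\<close> by (auto intro!: card_mono)
  then have F': "card F \<le> 2 * card F'" unfolding F'_def
    using F(3) fin q \<open>finite Y\<close> by (intro spread_avoid[where R = R]) auto
  have G': "card G \<le> 2 * card G'" unfolding G'_def
    using G(3) fin q \<open>finite X\<close> YX by (intro spread_avoid[where R = R]) auto
  have ne: "F' \<noteq> {}" "G' \<noteq> {}"
    using F' G' F(2) G(2) fin by (metis card.empty card_gt_0_iff mult_0_right not_le)+
  have "\<exists>\<sigma>\<in>F'. \<exists>\<tau>\<in>G'. (pairs n \<sigma> - X) \<inter> (pairs n \<tau> - Y) = {}"
  proof (rule spread_disjoint_members[where U = "{1..n} \<times> {1..n}" and R = "R / 2" and k = n and t = t])
    show "spread (R / 2) F' (\<lambda>\<sigma>. pairs n \<sigma> - X)"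
      by (rule spread_mono[OF _ F(3)]) (use fin F' q in \<open>auto simp: F'_def\<close>)
    show "spread (R / 2) G' (\<lambda>\<sigma>. pairs n \<sigma> - Y)"
      by (rule spread_mono[OF _ G(3)]) (use fin G' q in \<open>auto simp: G'_def\<close>)
    show "pairs n \<sigma> - X \<subseteq> {1..n} \<times> {1..n}" if "\<sigma> \<in> F'" for \<sigma>
      using that F(1) pairs_subset_grid unfolding F'_def by blast
    show "pairs n \<sigma> - Y \<subseteq> {1..n} \<times> {1..n}" if "\<sigma> \<in> G'" for \<sigma>
      using that G(1) pairs_subset_grid unfolding G'_def by blast
    show "card (pairs n \<sigma> - Z) \<le> n" for \<sigma> Z
      using card_mono[of "pairs n \<sigma>" "pairs n \<sigma> - Z"] by simp
    then show "card (pairs n \<sigma> - Z) \<le> n" for \<sigma> Z .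
  qed (use fin q t ne in \<open>auto simp: F'_def G'_def\<close>)
  then obtain \<sigma> \<tau> where st: "\<sigma> \<in> F'" "\<tau> \<in> G'" "(pairs n \<sigma> - X) \<inter> (pairs n \<tau> - Y) = {}" by blast
  then have "X \<subseteq> pairs n \<sigma>" "Y \<subseteq> pairs n \<tau>" using F(4) G(4) by (auto simp: F'_def G'_def)
  then have "pairs n \<sigma> \<inter> pairs n \<tau> = X \<inter> Y" using st unfolding F'_def G'_def by blast
  then show ?thesis using st unfolding F'_def G'_def by blast
qed

text \<open>Containing \<open>p\<close> and a nonempty \<open>Y\<close> is a condition on
  \<open>card Y + 1\<close> pairs. The two extra powers of \<open>R\<close> beyond
  \<open>card Y - 1\<close> pay for the loss \<open>C\<close> in size and for one factor
  \<open>R'\<close>.\<close>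

lemma spread_containing_pair:
  fixes R C :: real
  assumes "finite F" "spread R F (\<lambda>\<sigma>. pairs n \<sigma> - X)" "\<And>\<sigma>. \<sigma> \<in> F \<Longrightarrow> X \<subseteq> pairs n \<sigma>"
    and C: "card F \<le> C * card {\<sigma>\<in>F. p \<in> pairs n \<sigma>}" "C > 0"
    and R: "0 < R'" "R' \<le> R" "C * R' \<le> R\<^sup>2"
  shows "spread R' {\<sigma>\<in>F. p \<in> pairs n \<sigma>} (\<lambda>\<sigma>. pairs n \<sigma> - insert p X)"
  unfolding spread_def
proof (intro allI impI)
  fix Y :: "(nat \<times> nat) set" assume "finite Y"
  let ?F = "{\<sigma>\<in>F. p \<in> pairs n \<sigma>}"
  let ?N = "{\<sigma>\<in>?F. Y \<subseteq> pairs n \<sigma> - insert p X}"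
  show "real (card ?N) * R' ^ card Y \<le> real (card ?F)"
  proof (cases "p \<in> X")
    case True
    then have "?F = F" "insert p X = X" using assms(3) by auto
    moreover have "real (card {\<sigma>\<in>F. Y \<subseteq> pairs n \<sigma> - X}) * R' ^ card Y
        \<le> card {\<sigma>\<in>F. Y \<subseteq> pairs n \<sigma> - X} * R ^ card Y"
      using R by (intro mult_left_mono power_mono) auto
    moreover have "\<dots> \<le> card F" using assms(2) \<open>finite Y\<close> unfolding spread_def by blast
    ultimately show ?thesis by simp
  next
    case p: False
    consider "Y = {}" | "?N = {}" | "Y \<noteq> {}" "p \<notin> Y" by blast
    then show ?thesis
    proof cases
      case 3
      then obtain y where y: "card Y = Suc y" using \<open>finite Y\<close> by (metis card_eq_0_iff not0_implies_Suc)
      have "?N \<subseteq> {\<sigma>\<in>F. insert p Y \<subseteq> pairs n \<sigma> - X}" using p by auto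
      then have "real (card ?N) * R ^ card (insert p Y) \<le> card {\<sigma>\<in>F. insert p Y \<subseteq> pairs n \<sigma> - X} * R ^ card (insert p Y)"
        using \<open>finite F\<close> R by (intro mult_right_mono) (auto intro!: card_mono)
      also have "\<dots> \<le> card F" using assms(2) \<open>finite Y\<close> unfolding spread_def by blast
      also have "\<dots> \<le> C * card ?F" by fact
      finally have *: "real (card ?N) * R ^ (y + 2) \<le> C * card ?F" using 3 y \<open>finite Y\<close> by simp
      have "C * (card ?N * R' ^ card Y) = card ?N * ((C * R') * R' ^ y)" by (simp add: y)
      also have "\<dots> \<le> card ?N * (R\<^sup>2 * R ^ y)"
        using R \<open>C > 0\<close> by (intro mult_left_mono mult_mono power_mono) auto
      also have "\<dots> \<le> C * card ?F" using * by (simp add: power_add mult_ac power2_eq_square)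
      finally show ?thesis using \<open>C > 0\<close> by simp
    next
      case 2 then show ?thesis by (simp only: card.empty)
    qed simp
  qed
qed

section \<open>Permutations inside half of the grid and popular pairs\<close>

lemma power_mult_fact_le: "a ^ m * fact a \<le> (fact (a + m) :: nat)"
proof (induction m)
  case (Suc m)
  have "a ^ Suc m * fact a = a * (a ^ m * fact a)" by simp
  also have "\<dots> \<le> (a + Suc m) * fact (a + m)" by (intro mult_mono Suc.IH) auto
  finally show ?case by simp
qed simp

lemma power_le_binomial_fact: "m \<le> h \<Longrightarrow> (h - m) ^ m \<le> (h choose m) * fact m"
proof -
  assume "m \<le> h"
  then have "(h - m) ^ m * fact (h - m) \<le> ((h choose m) * fact m) * fact (h - m)"
    using power_mult_fact_le[of "h - m" m] binomial_fact_lemma[of m h] by (simp add: mult_ac)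
  then show ?thesis by simp
qed

text \<open>Comparing the number of \<open>m\<close>-subsets of the members of \<open>F\<close> inside \<open>H\<close> with the number of all
  \<open>m\<close>-subsets of \<open>H\<close>.\<close>
lemma card_mostly_inside:
  assumes F: "F \<subseteq> Sym n" and H: "finite H" "2 * card H \<le> n\<^sup>2" and "n \<ge> 10"
    and out: "\<And>\<sigma>. \<sigma> \<in> F \<Longrightarrow> card (pairs n \<sigma> - H) \<le> n div 50"
  shows "real (card F) \<le> (7 / 10) ^ (n div 10) * fact n"
proof -
  \<comment> \<open>Every member of \<open>F\<close> has at least \<open>h\<close> pairs inside
    \<open>H\<close>. Taking \<open>m\<close> linear in \<open>n\<close> makes the resulting ratio
    exponentially small.\<close>
  define m h where "m = n div 10" and "h = n - n div 50"
  have mh: "m \<le> h" "m \<le> n" using \<open>n \<ge> 10\<close> unfolding m_def h_def by linarith+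
  define P where "P = {Y. Y \<subseteq> H \<and> card Y = m}"
  have finP: "finite P" using H unfolding P_def by simp
  have finF: "finite F" using F finite_Sym finite_subset by blast
  have "card F * (h choose m) = (\<Sum>\<sigma>\<in>F. h choose m)" by simp
  also have "\<dots> \<le> (\<Sum>\<sigma>\<in>F. card {Y\<in>P. Y \<subseteq> pairs n \<sigma>})"
  proof (rule sum_mono)
    fix \<sigma> assume "\<sigma> \<in> F"
    have "card (pairs n \<sigma> \<inter> H) + card (pairs n \<sigma> - H) = n"
      using card_Int_Diff[of "pairs n \<sigma>" H] by simp
    then have "h \<le> card (pairs n \<sigma> \<inter> H)" using out[OF \<open>\<sigma> \<in> F\<close>] unfolding h_def by linarith
    then have "h choose m \<le> card (pairs n \<sigma> \<inter> H) choose m" by (rule binomial_right_mono)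
    also have "\<dots> = card {Y. Y \<subseteq> pairs n \<sigma> \<inter> H \<and> card Y = m}"
      by (rule n_subsets[symmetric]) simp
    also have "{Y. Y \<subseteq> pairs n \<sigma> \<inter> H \<and> card Y = m} = {Y\<in>P. Y \<subseteq> pairs n \<sigma>}" by (auto simp: P_def)
    finally show "h choose m \<le> card {Y\<in>P. Y \<subseteq> pairs n \<sigma>}" .
  qed
  also have "\<dots> = (\<Sum>Y\<in>P. card {\<sigma>\<in>F. Y \<subseteq> pairs n \<sigma>})"
    by (rule sum_multicount_gen) (use finP finF in auto)
  also have "\<dots> \<le> (\<Sum>Y\<in>P. fact (n - m))"
  proof (rule sum_mono)
    fix Y assume "Y \<in> P"
    have "card {\<sigma>\<in>F. Y \<subseteq> pairs n \<sigma>} \<le> card {\<sigma>\<in>Sym n. Y \<subseteq> pairs n \<sigma>}"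
      using F finite_Sym[of n] by (intro card_mono) auto
    also have "\<dots> \<le> fact (n - m)" using card_Sym_containing[of n Y] \<open>Y \<in> P\<close> by (simp add: P_def)
    finally show "card {\<sigma>\<in>F. Y \<subseteq> pairs n \<sigma>} \<le> fact (n - m)" .
  qed
  also have "\<dots> = (card H choose m) * fact (n - m)" using H by (simp add: P_def n_subsets)
  finally have 1: "card F * (h choose m) \<le> (card H choose m) * fact (n - m)" .
  have "card F * (h - m) ^ m * (n - m) ^ m \<le> card F * ((h choose m) * fact m) * (n - m) ^ m"
    using power_le_binomial_fact[OF mh(1)] by (intro mult_mono) auto
  also have "\<dots> = (card F * (h choose m)) * (fact m * (n - m) ^ m)" by (simp add: mult_ac)
  also have "\<dots> \<le> ((card H choose m) * fact (n - m)) * (fact m * (n - m) ^ m)"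
    using 1 by (rule mult_right_mono) simp
  also have "\<dots> = (fact m * (card H choose m)) * ((n - m) ^ m * fact (n - m))" by (simp add: mult_ac)
  also have "\<dots> \<le> card H ^ m * fact n"
    using power_mult_fact_le[of "n - m" m] binomial_fact_pow[of "card H" m] mh
    by (intro mult_mono) (simp_all add: mult.commute)
  finally have 2: "real (card F * (h - m) ^ m * (n - m) ^ m) \<le> real (card H ^ m * fact n)"
    by (rule of_nat_mono)
  \<comment> \<open>Together \<open>n div 50\<close> and \<open>n div 10\<close> are at most 12
    percent of \<open>n\<close>. The decay rate 7/10 works because 0.88 * 0.9 = 0.792 and 1/2 is
    below 0.7 * 0.792.\<close>
  have r: "88 / 100 * real n \<le> h - m" "9 / 10 * real n \<le> n - m"
    using mh unfolding h_def m_def by linarith+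
  have "real (card F) * (792 / 1000 * (real n)\<^sup>2) ^ m = card F * (88 / 100 * real n) ^ m * (9 / 10 * real n) ^ m"
    by (simp add: power_mult_distrib[symmetric] power2_eq_square)
  also have "\<dots> \<le> card F * real (h - m) ^ m * real (n - m) ^ m"
    using r by (intro mult_mono power_mono) auto
  also have "\<dots> \<le> real (card H) ^ m * fact n" using 2 by simp
  also have "\<dots> \<le> (1 / 2 * (real n)\<^sup>2) ^ m * fact n"
  proof (intro mult_right_mono power_mono)
    show "real (card H) \<le> 1 / 2 * (real n)\<^sup>2"
      using of_nat_mono[OF H(2), where 'a = real] by simp
  qed auto
  also have "\<dots> \<le> (7 / 10 * (792 / 1000 * (real n)\<^sup>2)) ^ m * fact n"
    by (intro mult_right_mono power_mono) auto
  also have "\<dots> = ((7 / 10) ^ m * fact n) * (792 / 1000 * (real n)\<^sup>2) ^ m"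
    by (simp only: power_mult_distrib mult_ac)
  finally show ?thesis unfolding m_def[symmetric]
    by (rule mult_right_le_imp_le) (use \<open>n \<ge> 10\<close> in simp)
qed

text \<open>The unpopular pairs outside \<open>H\<close> account for at most
  \<open>n * card F / 100\<close> incidences. Hence at most half of \<open>F\<close> can have more
  than \<open>n div 50\<close> pairs there, and the rest lies mostly inside
  \<open>H\<close>.\<close>

lemma card_few_popular:
  assumes F: "F \<subseteq> Sym n" and H: "H \<subseteq> {1..n} \<times> {1..n}" "2 * card H \<le> n\<^sup>2" and n: "n \<ge> 10"
    and pop: "\<And>p. p \<in> {1..n} \<times> {1..n} - H \<Longrightarrow> 100 * n * card {\<sigma>\<in>F. p \<in> pairs n \<sigma>} \<le> card F"
  shows "real (card F) \<le> 2 * (7 / 10) ^ (n div 10) * fact n"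
proof -
  let ?grid = "{1..n} \<times> {1..n}"
  define F' where "F' = {\<sigma>\<in>F. card (pairs n \<sigma> - H) \<le> n div 50}"
  have finF: "finite F" using F finite_Sym finite_subset by blast
  have finH: "finite H" using H(1) finite_subset by blast
  have "card (F - F') * n \<le> (\<Sum>\<sigma>\<in>F - F'. 50 * card (pairs n \<sigma> - H))"
  proof -
    have "n \<le> 50 * card (pairs n \<sigma> - H)" if "\<sigma> \<in> F - F'" for \<sigma>
      using that unfolding F'_def by auto
    then have "(\<Sum>\<sigma>\<in>F - F'. n) \<le> (\<Sum>\<sigma>\<in>F - F'. 50 * card (pairs n \<sigma> - H))" by (rule sum_mono)
    then show ?thesis by simp
  qed
  also have "\<dots> \<le> (\<Sum>\<sigma>\<in>F. 50 * card (pairs n \<sigma> - H))"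
    using finF by (intro sum_mono2) auto
  also have "\<dots> = 50 * (\<Sum>\<sigma>\<in>F. card {p\<in>?grid - H. p \<in> pairs n \<sigma>})"
  proof -
    have "pairs n \<sigma> - H = {p\<in>?grid - H. p \<in> pairs n \<sigma>}" if "\<sigma> \<in> F" for \<sigma>
      using that F pairs_subset_grid by blast
    then show ?thesis by (simp add: sum_distrib_left)
  qed
  also have "(\<Sum>\<sigma>\<in>F. card {p\<in>?grid - H. p \<in> pairs n \<sigma>}) = (\<Sum>p\<in>?grid - H. card {\<sigma>\<in>F. p \<in> pairs n \<sigma>})"
    by (rule sum_multicount_gen) (use finF in auto)
  finally have "2 * n * (card (F - F') * n) \<le> 2 * n * (50 * (\<Sum>p\<in>?grid - H. card {\<sigma>\<in>F. p \<in> pairs n \<sigma>}))"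
    by (rule mult_le_mono2)
  also have "\<dots> = (\<Sum>p\<in>?grid - H. 100 * n * card {\<sigma>\<in>F. p \<in> pairs n \<sigma>})"
    by (simp add: sum_distrib_left mult_ac)
  also have "\<dots> \<le> (\<Sum>p\<in>?grid - H. card F)" by (intro sum_mono pop)
  also have "\<dots> \<le> card F * n\<^sup>2"
    using card_mono[of ?grid "?grid - H"] by (simp add: power2_eq_square mult.commute)
  finally have "n\<^sup>2 * (2 * card (F - F')) \<le> n\<^sup>2 * card F" by (simp add: power2_eq_square mult_ac)
  then have "2 * card (F - F') \<le> card F" using n by simp
  moreover have "card F = card F' + card (F - F')"
    using card_Int_Diff[OF finF, of F'] by (simp add: F'_def Int_absorb1 Collect_conj_eq Int_commute)
  ultimately have "real (card F) \<le> 2 * real (card F')" by linarith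
  also have "real (card F') \<le> (7 / 10) ^ (n div 10) * fact n"
    by (rule card_mostly_inside[OF _ finH H(2) n]) (use F in \<open>auto simp: F'_def\<close>)
  finally show ?thesis by simp
qed

text \<open>In each family the popular pairs fill more than half of the grid, since otherwise they
  could serve as \<open>H\<close> in the preceding bound. Two such sets meet.\<close>

lemma exists_common_popular_pair:
  assumes F: "F \<subseteq> Sym n" "2 * (7 / 10) ^ (n div 10) * fact n < real (card F)"
    and G: "G \<subseteq> Sym n" "2 * (7 / 10) ^ (n div 10) * fact n < real (card G)" and n: "n \<ge> 10"
  shows "\<exists>p. card F \<le> 100 * n * card {\<sigma>\<in>F. p \<in> pairs n \<sigma>} \<and>
             card G \<le> 100 * n * card {\<sigma>\<in>G. p \<in> pairs n \<sigma>}"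
proof (rule ccontr)
  assume neg: "\<not> ?thesis"
  let ?grid = "{1..n} \<times> {1..n}"
  define pop where "pop F = {p\<in>?grid. card F \<le> 100 * n * card {\<sigma>\<in>F. p \<in> pairs n \<sigma>}}" for F
  have half: "n\<^sup>2 < 2 * card (pop E)"
    if E: "E \<subseteq> Sym n" "2 * (7 / 10) ^ (n div 10) * fact n < real (card E)" for E
  proof (rule ccontr)
    assume "\<not> ?thesis"
    then have "real (card E) \<le> 2 * (7 / 10) ^ (n div 10) * fact n"
      by (intro card_few_popular[OF E(1), of "pop E"] n) (auto simp: pop_def)
    then show False using E(2) by simp
  qed
  have "pop F \<inter> pop G = {}" using neg unfolding pop_def by blast
  then have "card (pop F) + card (pop G) = card (pop F \<union> pop G)"
    by (intro card_Un_disjoint[symmetric]) (auto simp: pop_def)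
  also have "\<dots> \<le> card ?grid" by (intro card_mono) (auto simp: pop_def)
  also have "\<dots> = n\<^sup>2" by (simp add: power2_eq_square)
  finally show False using half[OF F] half[OF G] by linarith
qed

section \<open>Single agreements\<close>

text \<open>The lower bounds on \<open>n\<close> needed below. Spreadness starts at
  \<open>n powr (4 / 5)\<close>; fixing a popular pair lowers it to the square of this over
  \<open>100 * n\<close>, which is \<open>n powr (3 / 5) / 100\<close>. The number 31 is the size
  bound 30 plus that pair. The condition with \<open>exp 1\<close> yields the size bound; the last
  one makes families of size \<open>fact n / n ^ 33\<close> dense enough to have popular
  pairs.\<close>

definition large :: "nat \<Rightarrow> bool" where
  "large n \<longleftrightarrow> n \<ge> 10 \<and> exp 1 \<le> real n powr (1 / 10)
     \<and> 2 * 31 \<le> real n powr (3 / 5) / 100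
     \<and> real n powr (3 / 5) / 100 \<le> real n powr (4 / 5)
     \<and> 16 * exp (12 * n / (real n powr (3 / 5) / 100)) \<le> 2 powr sqrt n
     \<and> exp (16 * (sqrt n + 1) / (real n powr (3 / 5) / 100)) \<le> 5 / 4
     \<and> 2 * (7 / 10) powr (n / 10 - 1) * real n ^ 33 < 1"

lemma eventually_large: "\<exists>n0. \<forall>n\<ge>n0. large n"
proof -
  have 1: "eventually (\<lambda>n::nat. n \<ge> 10) at_top" by (rule eventually_ge_at_top)
  have 2: "eventually (\<lambda>n::nat. exp 1 \<le> real n powr (1 / 10)) at_top" by real_asymp
  have 3: "eventually (\<lambda>n::nat. 2 * 31 \<le> real n powr (3 / 5) / 100) at_top" by real_asymp
  have 4: "eventually (\<lambda>n::nat. real n powr (3 / 5) / 100 \<le> real n powr (4 / 5)) at_top" by real_asymp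
  have 5: "eventually (\<lambda>n::nat. 16 * exp (12 * n / (real n powr (3 / 5) / 100)) \<le> 2 powr sqrt n) at_top" by real_asymp
  have 6: "eventually (\<lambda>n::nat. exp (16 * (sqrt n + 1) / (real n powr (3 / 5) / 100)) \<le> 5 / 4) at_top" by real_asymp
  have 7: "eventually (\<lambda>n::nat. 2 * (7 / 10) powr (n / 10 - 1) * real n ^ 33 < 1) at_top" by real_asymp
  have "eventually large at_top"
    unfolding large_def using 1 2 3 4 5 6 7 by (intro eventually_conj) simp_all
  then show ?thesis by (simp add: eventually_at_top_linorder)
qed

text \<open>The choice of \<open>t\<close> near \<open>sqrt n\<close> suits both requirements: up to
  constants \<open>t\<close> must exceed \<open>n / R\<close>, of order
  \<open>n powr (2 / 5)\<close>, and be small compared with \<open>R\<close>, of order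
  \<open>n powr (3 / 5)\<close>.\<close>

lemma exists_meeting_exactly_large:
  assumes n: "large n"
    and F: "F \<subseteq> Sym n" "F \<noteq> {}" "spread (real n powr (3 / 5) / 100) F (\<lambda>\<sigma>. pairs n \<sigma> - X)"
      "\<And>\<sigma>. \<sigma> \<in> F \<Longrightarrow> X \<subseteq> pairs n \<sigma>" "card X \<le> 31"
    and G: "G \<subseteq> Sym n" "G \<noteq> {}" "spread (real n powr (3 / 5) / 100) G (\<lambda>\<sigma>. pairs n \<sigma> - Y)"
      "\<And>\<sigma>. \<sigma> \<in> G \<Longrightarrow> Y \<subseteq> pairs n \<sigma>" "card Y \<le> 31"
  shows "\<exists>\<sigma>\<in>F. \<exists>\<tau>\<in>G. pairs n \<sigma> \<inter> pairs n \<tau> = X \<inter> Y"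
proof -
  define R where "R = real n powr (3 / 5) / 100"
  define t where "t = nat \<lceil>sqrt n\<rceil>"
  have R: "62 \<le> R" and l1: "16 * exp (12 * n / R) \<le> 2 powr sqrt n"
    and l2: "exp (16 * (sqrt n + 1) / R) \<le> 5 / 4"
    using n unfolding large_def R_def by auto
  have "0 \<le> \<lceil>sqrt n\<rceil>" using ceiling_mono[of 0 "sqrt n"] by simp
  then have t: "sqrt n \<le> t" "t \<le> sqrt n + 1" unfolding t_def by linarith+
  have pow: "(1 + a / R) ^ k \<le> exp (a * k / R)" if "a \<ge> 0" for a :: real and k
  proof -
    have "(1 + a / R) ^ k \<le> exp (a / R) ^ k"
      using R that by (intro power_mono exp_ge_add_one_self) auto
    also have "\<dots> = exp (a * k / R)" by (simp add: exp_of_nat_mult[symmetric] mult_ac)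
    finally show ?thesis .
  qed
  have "16 * (1 + 12 / R) ^ n \<le> 16 * exp (12 * n / R)" using pow[of 12 n] by simp
  also have "\<dots> \<le> 2 powr sqrt n" by (rule l1)
  also have "\<dots> \<le> 2 powr t" using t by (intro powr_mono) auto
  also have "\<dots> = 2 ^ t" by (simp add: powr_realpow)
  finally have t1: "16 * (1 + 12 / R) ^ n \<le> 2 ^ t" .
  have "(1 + 16 / R) ^ t \<le> exp (16 * t / R)" using pow[of 16 t] by simp
  also have "\<dots> \<le> exp (16 * (sqrt n + 1) / R)"
    using t R by (simp add: divide_right_mono)
  also have "\<dots> \<le> 5 / 4" by (rule l2)
  finally have t2: "(1 + 16 / R) ^ t \<le> 5 / 4" .
  show ?thesis
    by (rule exists_meeting_exactly[where R = R and t = t])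
      (use F G R t1 t2 in \<open>auto simp: R_def\<close>)
qed

text \<open>If \<open>X\<close> and \<open>Y\<close> share one pair, they can be used as they are.
  If they are disjoint, both families are restricted to a common popular pair, which becomes the
  only agreement.\<close>

lemma exists_single_agreement:
  assumes n: "large n"
    and F: "F \<subseteq> Sym n" "spread (real n powr (4 / 5)) F (\<lambda>\<sigma>. pairs n \<sigma> - X)"
      "\<And>\<sigma>. \<sigma> \<in> F \<Longrightarrow> X \<subseteq> pairs n \<sigma>" "card X \<le> 30" "fact n \<le> card F * n ^ 33"
    and G: "G \<subseteq> Sym n" "spread (real n powr (4 / 5)) G (\<lambda>\<sigma>. pairs n \<sigma> - Y)"
      "\<And>\<sigma>. \<sigma> \<in> G \<Longrightarrow> Y \<subseteq> pairs n \<sigma>" "card Y \<le> 30" "fact n \<le> card G * n ^ 33"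
    and XY: "card (X \<inter> Y) \<le> 1"
  shows "\<exists>\<sigma>\<in>F. \<exists>\<tau>\<in>G. card (pairs n \<sigma> \<inter> pairs n \<tau>) = 1"
proof -
  define R where "R = real n powr (4 / 5)"
  define R' where "R' = real n powr (3 / 5) / 100"
  have n10: "n \<ge> 10" using n by (simp add: large_def)
  have R': "0 < R'" "R' \<le> R" using n by (auto simp: large_def R_def R'_def)
  have RR: "100 * n * R' = R\<^sup>2"
  proof -
    have "R\<^sup>2 = real n powr (8 / 5)" by (simp add: R_def power2_eq_square powr_add[symmetric])
    also have "\<dots> = real n powr (1 + 3 / 5)" by simp
    also have "\<dots> = real n powr 1 * real n powr (3 / 5)" by (rule powr_add)
    finally show ?thesis using n10 by (simp add: R'_def)
  qed
  have ne: "F \<noteq> {}" "G \<noteq> {}" using F(5) G(5) by (metis card.empty fact_nonzero le_zero_eq mult_0)+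
  have fin: "finite F" "finite G" using F(1) G(1) finite_Sym finite_subset by blast+
  show ?thesis
  proof (cases "card (X \<inter> Y) = 1")
    case True
    have "spread R' F (\<lambda>\<sigma>. pairs n \<sigma> - X)" "spread R' G (\<lambda>\<sigma>. pairs n \<sigma> - Y)"
      using spread_antimono[OF F(2), of R'] spread_antimono[OF G(2), of R'] R' by (simp_all add: R_def)
    then have "\<exists>\<sigma>\<in>F. \<exists>\<tau>\<in>G. pairs n \<sigma> \<inter> pairs n \<tau> = X \<inter> Y"
      by (intro exists_meeting_exactly_large[OF n]) (use F G ne in \<open>auto simp: R'_def\<close>)
    then show ?thesis using True by metis
  next
    case False
    have "finite X" using F(3) ne(1) finite_pairs finite_subset by (meson ex_in_conv)
    then have disj: "X \<inter> Y = {}" using False XY by (simp add: le_Suc_eq card_eq_0_iff)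
    \<comment> \<open>A polynomial loss \<open>n ^ 33\<close> is beaten by the exponentially small
      bound for families without enough popular pairs.\<close>
    have dense: "2 * (7 / 10) ^ (n div 10) * fact n < real (card E)"
      if "fact n \<le> card E * n ^ 33" for E :: "(nat \<Rightarrow> nat) set"
    proof -
      have "real (fact n) \<le> real (card E * n ^ 33)" using that by (rule of_nat_mono)
      then have E: "fact n \<le> card E * real n ^ 33" by simp
      have "(7 / 10 :: real) ^ (n div 10) = (7 / 10) powr (n div 10)" by (simp add: powr_realpow)
      also have "\<dots> \<le> (7 / 10) powr (n / 10 - 1)"
      proof (rule powr_mono')
        show "n / 10 - 1 \<le> real (n div 10)" by linarith
      qed auto
      finally have "2 * (7 / 10) ^ (n div 10) * real n ^ 33 \<le> 2 * (7 / 10) powr (n / 10 - 1) * real n ^ 33"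
        by (intro mult_right_mono mult_left_mono) auto
      also have "\<dots> < 1" using n by (simp add: large_def)
      finally have "2 * (7 / 10) ^ (n div 10) * real n ^ 33 < 1" .
      moreover have "card E > 0" by (rule Nat.gr0I) (use that in simp)
      ultimately have less: "card E * (2 * (7 / 10) ^ (n div 10) * real n ^ 33) < real (card E) * 1"
        by (intro mult_strict_left_mono) simp_all
      have "2 * (7 / 10) ^ (n div 10) * fact n \<le> 2 * (7 / 10) ^ (n div 10) * (card E * real n ^ 33)"
        using E by (intro mult_left_mono) auto
      also have "\<dots> = card E * (2 * (7 / 10) ^ (n div 10) * real n ^ 33)" by (simp only: mult_ac)
      also have "\<dots> < real (card E) * 1" by (rule less)
      finally show ?thesis by simp
    qed
    obtain p where p: "card F \<le> 100 * n * card {\<sigma>\<in>F. p \<in> pairs n \<sigma>}"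
        "card G \<le> 100 * n * card {\<sigma>\<in>G. p \<in> pairs n \<sigma>}"
      using exists_common_popular_pair[OF F(1) dense[OF F(5)] G(1) dense[OF G(5)] n10] by blast
    let ?F = "{\<sigma>\<in>F. p \<in> pairs n \<sigma>}" and ?G = "{\<sigma>\<in>G. p \<in> pairs n \<sigma>}"
    have "\<exists>\<sigma>\<in>?F. \<exists>\<tau>\<in>?G. pairs n \<sigma> \<inter> pairs n \<tau> = insert p X \<inter> insert p Y"
    proof (rule exists_meeting_exactly_large[OF n])
      show "spread (real n powr (3 / 5) / 100) ?F (\<lambda>\<sigma>. pairs n \<sigma> - insert p X)"
        unfolding R'_def[symmetric]
        by (rule spread_containing_pair[where C = "100 * real n" and R = R])
          (use F fin R' RR n10 of_nat_mono[OF p(1), where 'a = real] in \<open>auto simp: R_def\<close>)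
      show "spread (real n powr (3 / 5) / 100) ?G (\<lambda>\<sigma>. pairs n \<sigma> - insert p Y)"
        unfolding R'_def[symmetric]
        by (rule spread_containing_pair[where C = "100 * real n" and R = R])
          (use G fin R' RR n10 of_nat_mono[OF p(2), where 'a = real] in \<open>auto simp: R_def\<close>)
      show "?F \<noteq> {}" "?G \<noteq> {}" using p ne fin by (metis card.empty card_0_eq le_zero_eq mult_0_right)+
      show "card (insert p X) \<le> 31" "card (insert p Y) \<le> 31"
        using F(4) G(4) card_insert_le_m1[of 31 X p] card_insert_le_m1[of 31 Y p] by auto
    qed (use F G in auto)
    then obtain \<sigma> \<tau> where "\<sigma> \<in> F" "\<tau> \<in> G" "pairs n \<sigma> \<inter> pairs n \<tau> = insert p X \<inter> insert p Y"
      by blast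
    moreover have "insert p X \<inter> insert p Y = {p}" using disj by blast
    ultimately have "card (pairs n \<sigma> \<inter> pairs n \<tau>) = 1" by (simp only:) simp
    then show ?thesis using \<open>\<sigma> \<in> F\<close> \<open>\<tau> \<in> G\<close> by blast
  qed
qed

section \<open>Spread parts of large families\<close>

text \<open>Combine \<open>(n / x) ^ x \<le> n choose x\<close> with the bound
  \<open>x ^ x \<le> exp 1 ^ x * fact x\<close>, which is read off a single term of the exponential
  series at \<open>x\<close>.\<close>

lemma power_div_exp_le_fact:
  assumes "x \<le> n"
  shows "(real n / exp 1) ^ x * fact (n - x) \<le> fact n"
proof (cases "x = 0")
  case False
  have "(\<lambda>k. real x ^ k /\<^sub>R fact k) sums exp (real x)" by (rule exp_converges)
  then have "(\<Sum>k\<in>{x}. real x ^ k /\<^sub>R fact k) \<le> exp (real x)"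
    using sum_le_suminf[of "\<lambda>k. real x ^ k /\<^sub>R fact k" "{x}"] sums_summable sums_unique by fastforce
  then have x: "real x ^ x \<le> exp 1 ^ x * fact x"
    by (simp add: field_simps exp_of_nat_mult[symmetric])
  have "real n ^ x = (real n / real x) ^ x * real x ^ x" using False by (simp add: power_divide)
  also have "\<dots> \<le> real (n choose x) * (exp 1 ^ x * fact x)"
    using binomial_ge_n_over_k_pow_k[OF assms, where 'a = real] x by (intro mult_mono) auto
  finally have "(real n / exp 1) ^ x \<le> real (n choose x) * fact x" by (simp add: power_divide field_simps)
  then have "(real n / exp 1) ^ x * fact (n - x) \<le> real (n choose x) * fact x * fact (n - x)"
    by (rule mult_right_mono) simp
  also have "\<dots> = real (fact x * fact (n - x) * (n choose x))" by simp
  also have "\<dots> = fact n" by (simp only: binomial_fact_lemma[OF assms] of_nat_fact)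
  finally show ?thesis .
qed simp

text \<open>\<open>X\<close> is a maximal set contained in at least a fraction \<open>n powr (- 4 / 5 * card X)\<close> of the members
  of \<open>A\<close>; comparing with the \<open>fact (n - card X)\<close> permutations containing \<open>X\<close> bounds its size. The exponent
  33 is 30 + 3, the 3 coming from \<open>fact n \<le> n ^ 3 * fact (n - 3)\<close>.\<close>
lemma exists_spread_part:
  assumes n: "large n" and A: "A \<subseteq> Sym n" "fact (n - 3) < card A"
  shows "\<exists>X. card X \<le> 30 \<and> spread (real n powr (4 / 5)) {\<sigma>\<in>A. X \<subseteq> pairs n \<sigma>} (\<lambda>\<sigma>. pairs n \<sigma> - X)
           \<and> fact n \<le> card {\<sigma>\<in>A. X \<subseteq> pairs n \<sigma>} * n ^ 33"
proof -
  define R where "R = real n powr (4 / 5)"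
  define link where "link X = {\<sigma>\<in>A. X \<subseteq> pairs n \<sigma>}" for X
  define Q where "Q = {X\<in>Pow ({1..n} \<times> {1..n}). real (card A) \<le> card (link X) * R ^ card X}"
  have n10: "n \<ge> 10" using n by (simp add: large_def)
  then have R: "R > 0" by (simp add: R_def)
  have finA: "finite A" using A(1) finite_Sym finite_subset by blast
  have finl: "finite (link X)" for X using finA by (simp add: link_def)
  have "finite Q" by (simp add: Q_def)
  moreover have "{} \<in> Q" by (simp add: Q_def link_def)
  ultimately have "Max (card ` Q) \<in> card ` Q" by (intro Max_in) auto
  then obtain X where X: "X \<in> Q" and "card X = Max (card ` Q)" by auto
  then have Xmax: "card Y \<le> card X" if "Y \<in> Q" for Y using that \<open>finite Q\<close> by simp
  have XA: "real (card A) \<le> card (link X) * R ^ card X" and Xg: "X \<subseteq> {1..n} \<times> {1..n}"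
    using X by (auto simp: Q_def)
  have finX: "finite X" using Xg finite_subset by blast
  have "card (link X) \<noteq> 0" using XA A(2) by (auto intro!: Nat.gr0I)
  then obtain \<sigma> where "\<sigma> \<in> A" "X \<subseteq> pairs n \<sigma>" by (metis card.empty ex_in_conv link_def mem_Collect_eq)
  then have xn: "card X \<le> n" using card_mono[of "pairs n \<sigma>" X] by simp
  have "(real n / exp 1) ^ card X * fact (n - card X) \<le> fact n"
    by (rule power_div_exp_le_fact) fact
  also have nn: "\<dots> \<le> fact (n - 3) * real n ^ 3"
  proof -
    have "fact n div fact (n - 3) \<le> n ^ 3" by (rule fact_div_fact_le_pow) (use n10 in simp)
    moreover have "fact (n - 3) * (fact n div fact (n - 3)) = (fact n :: nat)"
      by (intro dvd_mult_div_cancel fact_dvd) simp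
    ultimately have "(fact n :: nat) \<le> fact (n - 3) * n ^ 3" by (metis mult_le_mono2)
    from of_nat_mono[OF this, where 'a = real] show ?thesis by simp
  qed
  also have "\<dots> \<le> card A * real n ^ 3"
    using of_nat_mono[OF less_imp_le[OF A(2)], where 'a = real] by (intro mult_right_mono) auto
  also have A3: "card A * real n ^ 3 \<le> card (link X) * R ^ card X * real n ^ 3"
    using XA by (intro mult_right_mono) auto
  also have "\<dots> \<le> fact (n - card X) * R ^ card X * real n ^ 3"
  proof (intro mult_right_mono)
    have "card (link X) \<le> card {\<sigma>\<in>Sym n. X \<subseteq> pairs n \<sigma>}"
      unfolding link_def using A(1) finite_Sym[of n] by (intro card_mono) auto
    also have "\<dots> \<le> fact (n - card X)" by (rule card_Sym_containing)
    finally show "real (card (link X)) \<le> fact (n - card X)"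
      by (metis of_nat_fact of_nat_mono)
  qed (use R in auto)
  finally have "(real n / exp 1) ^ card X * fact (n - card X) \<le> (R ^ card X * real n ^ 3) * fact (n - card X)"
    by (simp add: mult_ac)
  then have le: "(real n / exp 1) ^ card X \<le> R ^ card X * real n ^ 3"
    by (rule mult_right_le_imp_le) simp
  \<comment> \<open>Each element of \<open>X\<close> now contributes a factor
    \<open>n powr (1 / 10)\<close>, against a total slack of \<open>n ^ 3\<close>; so
    \<open>X\<close> has at most 30 elements.\<close>
  have "R * real n powr (1 / 10) \<le> real n / exp 1"
  proof -
    have "exp 1 * (R * real n powr (1 / 10)) \<le> real n powr (1 / 10) * (R * real n powr (1 / 10))"
      using n R by (intro mult_right_mono) (auto simp: large_def)
    also have "\<dots> = real n" using n10 by (simp add: R_def powr_add[symmetric])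
    finally show ?thesis by (simp add: field_simps)
  qed
  then have "(R * real n powr (1 / 10)) ^ card X \<le> R ^ card X * real n ^ 3"
    using le R by (intro order_trans[OF power_mono le]) auto
  then have "(real n powr (1 / 10)) ^ card X \<le> real n ^ 3"
    using R by (simp add: power_mult_distrib)
  then have "real n powr (card X / 10) \<le> real n powr 3"
    using n10 powr_realpow[of "real n powr (1 / 10)" "card X"] powr_realpow[of "real n" 3]
    by (simp add: powr_powr)
  then have "card X / 10 \<le> (3::real)" using n10 by (subst (asm) powr_le_cancel_iff) auto
  then have card30: "card X \<le> 30" by simp
  have "fact n \<le> card A * real n ^ 3"
    using nn of_nat_mono[OF less_imp_le[OF A(2)], where 'a = real]
    by (elim order_trans) (intro mult_right_mono, auto)
  also have "\<dots> \<le> card (link X) * R ^ card X * real n ^ 3" by (rule A3)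
  also have "\<dots> \<le> card (link X) * real n ^ 30 * real n ^ 3"
  proof (intro mult_right_mono mult_left_mono)
    have "R \<le> real n powr 1" unfolding R_def using n10 by (intro powr_mono) auto
    then have "R ^ card X \<le> real n ^ card X" using R n10 by (intro power_mono) auto
    also have "\<dots> \<le> real n ^ 30" using card30 n10 by (intro power_increasing) auto
    finally show "R ^ card X \<le> real n ^ 30" .
  qed auto
  also have "\<dots> = real (card (link X) * n ^ 33)" by (simp add: power_add[symmetric])
  finally have big: "fact n \<le> card (link X) * n ^ 33" by (metis of_nat_fact of_nat_le_iff)
  have "spread R (link X) (\<lambda>\<sigma>. pairs n \<sigma> - X)"
    unfolding spread_def
  proof (intro allI impI)
    fix Y :: "(nat \<times> nat) set" assume "finite Y"
    let ?N = "{\<sigma>\<in>link X. Y \<subseteq> pairs n \<sigma> - X}"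
    consider "?N = {}" | "Y = {}" | "Y \<noteq> {}" "?N \<noteq> {}" by blast
    then show "real (card ?N) * R ^ card Y \<le> real (card (link X))"
    proof cases
      case 3
      then have Y: "Y \<inter> X = {}" "Y \<subseteq> {1..n} \<times> {1..n}"
        using A(1) pairs_subset_grid[of _ n] unfolding link_def by blast+
      then have cXY: "card (X \<union> Y) = card X + card Y"
        using finX \<open>finite Y\<close> by (intro card_Un_disjoint) auto
      \<comment> \<open>By maximality the larger set fails the threshold that \<open>X\<close>
        satisfies; comparing the two inequalities and cancelling \<open>R ^ card X\<close> is the
        spread condition for \<open>Y\<close>.\<close>
      then have "X \<union> Y \<notin> Q" using Xmax[of "X \<union> Y"] 3(1) \<open>finite Y\<close> card_gt_0_iff[of Y] by auto
      then have "card (link (X \<union> Y)) * R ^ card (X \<union> Y) < real (card A)"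
        using Xg Y(2) by (simp add: Q_def)
      moreover have "link (X \<union> Y) = ?N" using Y(1) by (auto simp: link_def)
      ultimately have "real (card ?N) * R ^ card Y * R ^ card X < card (link X) * R ^ card X"
        using XA cXY by (simp add: power_add mult_ac)
      then show ?thesis using R by simp
    next
      case 1 then show ?thesis by (simp only: card.empty)
    next
      case 2 then show ?thesis using finl by (auto intro!: card_mono)
    qed
  qed
  then show ?thesis using card30 big unfolding R_def link_def by blast
qed

section \<open>Set families with pairwise intersections of size at least two\<close>

text \<open>Without two common points, each pair \<open>x\<close>, \<open>y\<close> is missed in
  part by some member \<open>Z x y\<close>. Every \<open>X\<close> shares two points
  \<open>x\<close>, \<open>y\<close> with a fixed member, and meeting \<open>Z x y\<close> twice
  forces a third point of \<open>Z x y\<close> into \<open>X\<close>. There are at most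
  \<open>q ^ 2\<close> choices for the pair and \<open>q\<close> for the third point.\<close>

lemma pairwise_two_intersecting:
  fixes S :: "'a set set"
  assumes "S \<noteq> {}" and fin: "\<And>X. X \<in> S \<Longrightarrow> finite X" and q: "\<And>X. X \<in> S \<Longrightarrow> card X \<le> q"
    and two: "\<And>X Y. X \<in> S \<Longrightarrow> Y \<in> S \<Longrightarrow> 2 \<le> card (X \<inter> Y)"
  shows "(\<exists>T. finite T \<and> card T \<le> q ^ 3 \<and> (\<forall>t\<in>T. card t = 3) \<and> (\<forall>X\<in>S. \<exists>t\<in>T. t \<subseteq> X)) \<or>
    (\<exists>x y. x \<noteq> y \<and> (\<forall>X\<in>S. {x, y} \<subseteq> X))"
proof (rule disjCI)
  assume "\<not> (\<exists>x y. x \<noteq> y \<and> (\<forall>X\<in>S. {x, y} \<subseteq> X))"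
  then have "\<forall>x y. \<exists>X. x \<noteq> y \<longrightarrow> X \<in> S \<and> \<not> {x, y} \<subseteq> X" by blast
  then obtain Z where Z: "\<And>x y. x \<noteq> y \<Longrightarrow> Z x y \<in> S \<and> \<not> {x, y} \<subseteq> Z x y" by metis
  obtain X1 where X1: "X1 \<in> S" using \<open>S \<noteq> {}\<close> by blast
  define D where "D = {(x, y). x \<in> X1 \<and> y \<in> X1 \<and> x \<noteq> y}"
  define T where "T = (\<Union>(x, y)\<in>D. (\<lambda>z. {x, y, z}) ` (Z x y - {x, y}))"
  have D: "D \<subseteq> X1 \<times> X1" by (auto simp: D_def)
  have finD: "finite D" by (rule finite_subset[OF D]) (simp add: fin X1)
  have "card D \<le> card (X1 \<times> X1)" using D fin[OF X1] by (intro card_mono) auto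
  also have "\<dots> \<le> q * q" using q[OF X1] by (simp add: card_cartesian_product mult_le_mono)
  finally have cD: "card D \<le> q * q" .
  have finT: "finite T" unfolding T_def using finD Z fin by (auto simp: D_def)
  have "card T \<le> (\<Sum>(x, y)\<in>D. card ((\<lambda>z. {x, y, z}) ` (Z x y - {x, y})))"
    unfolding T_def using card_UN_le[OF finD, of "\<lambda>(x, y). (\<lambda>z. {x, y, z}) ` (Z x y - {x, y})"]
    by (simp add: case_prod_unfold)
  also have "\<dots> \<le> (\<Sum>(x, y)\<in>D. q)"
  proof (rule sum_mono, clarify)
    fix x y assume "(x, y) \<in> D"
    then have "Z x y \<in> S" using Z by (auto simp: D_def)
    then have "card ((\<lambda>z. {x, y, z}) ` (Z x y - {x, y})) \<le> card (Z x y)"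
      using fin by (meson card_Diff1_le card_image_le card_mono Diff_subset finite_Diff le_trans)
    then show "card ((\<lambda>z. {x, y, z}) ` (Z x y - {x, y})) \<le> q" using q[OF \<open>Z x y \<in> S\<close>] by simp
  qed
  also have "\<dots> \<le> q ^ 3" using cD by (simp add: power3_eq_cube mult_le_mono1)
  finally have "card T \<le> q ^ 3" .
  moreover have "\<forall>t\<in>T. card t = 3" by (auto simp: T_def D_def card_insert_if)
  moreover have "\<exists>t\<in>T. t \<subseteq> X" if X: "X \<in> S" for X
  proof -
    have "finite (X \<inter> X1)" using fin[OF X] by simp
    moreover have "\<not> card (X \<inter> X1) \<le> Suc 0" using two[OF X X1] by simp
    ultimately have "\<exists>x\<in>X \<inter> X1. \<exists>y\<in>X \<inter> X1. x \<noteq> y" by (simp add: card_le_Suc0_iff_eq)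
    then obtain x y where xy: "x \<in> X \<inter> X1" "y \<in> X \<inter> X1" "x \<noteq> y" by blast
    let ?Z = "Z x y"
    have "?Z \<in> S" "\<not> {x, y} \<subseteq> ?Z" using Z xy by blast+
    have "\<not> X \<inter> ?Z \<subseteq> {x, y}"
    proof
      assume sub: "X \<inter> ?Z \<subseteq> {x, y}"
      have "card {x, y} \<le> card (X \<inter> ?Z)" using two[OF X \<open>?Z \<in> S\<close>] xy by simp
      then have "X \<inter> ?Z = {x, y}" using sub by (intro card_seteq) auto
      then show False using \<open>\<not> {x, y} \<subseteq> ?Z\<close> by blast
    qed
    then obtain z where "z \<in> X" "z \<in> ?Z - {x, y}" by blast
    then have "{x, y, z} \<in> T" "{x, y, z} \<subseteq> X" using xy by (auto simp: T_def D_def)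
    then show ?thesis by blast
  qed
  ultimately show "\<exists>T. finite T \<and> card T \<le> q ^ 3 \<and> (\<forall>t\<in>T. card t = 3) \<and> (\<forall>X\<in>S. \<exists>t\<in>T. t \<subseteq> X)"
    using finT by blast
qed

section \<open>The alternative between a 2-star and a bounded cover by triples\<close>

theorem theorem4p1:
  fixes c :: real
  assumes "c > 0"
  shows "\<exists>K>0. \<forall>n::nat. \<forall>A. n \<ge> 3 \<longrightarrow> A \<subseteq> Sym n \<longrightarrow>
           no_singleton_intersection n A \<longrightarrow> real (card A) \<ge> c * fact (n - 2) \<longrightarrow>
           (\<exists>i\<in>{1..n}. \<exists>j\<in>{1..n}. \<exists>k\<in>{1..n}. \<exists>l\<in>{1..n}. i \<noteq> k \<and> j \<noteq> l \<and>
              real (card (A - fixing A [(i, j), (k, l)])) \<le> K * fact (n - 3))"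
proof -
  obtain n0 where n0: "\<And>n. n \<ge> n0 \<Longrightarrow> large n" using eventually_large by blast
  \<comment> \<open>The first summand absorbs all \<open>n < n0\<close>. The second is
    \<open>30 ^ 3 + 1\<close>: one \<open>fact (n - 3)\<close> for each triple and one for
    \<open>A0\<close>.\<close>
  define K :: real where "K = fact n0 + 27001"
  have "\<exists>i\<in>{1..n}. \<exists>j\<in>{1..n}. \<exists>k\<in>{1..n}. \<exists>l\<in>{1..n}. i \<noteq> k \<and> j \<noteq> l \<and>
              real (card (A - fixing A [(i, j), (k, l)])) \<le> K * fact (n - 3)"
    if n: "n \<ge> 3" and A: "A \<subseteq> Sym n" and ns: "no_singleton_intersection n A" for n A
  proof -
    have finA: "finite A" using A finite_Sym finite_subset by blast
    show ?thesis
    proof (cases "real (card A) \<le> K * fact (n - 3)")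
      case True
      have "card (A - fixing A [(1, 1), (2, 2)]) \<le> card A" using finA by (intro card_mono) auto
      then have "real (card (A - fixing A [(1, 1), (2, 2)])) \<le> K * fact (n - 3)" using True by linarith
      then show ?thesis using n by (intro bexI[of _ 1] bexI[of _ 2]) auto
    next
      case False
      have "card A \<le> fact n" using card_mono[OF finite_Sym A] by (simp add: card_Sym)
      then have "real (card A) \<le> fact n" by (metis of_nat_fact of_nat_mono)
      moreover have "fact n \<le> K * fact (n - 3)" if "n < n0"
      proof -
        have "(fact n :: real) \<le> fact n0" using that by (intro fact_mono) auto
        also have "\<dots> \<le> K * 1" by (simp add: K_def)
        also have "\<dots> \<le> K * fact (n - 3)" by (intro mult_left_mono) (auto simp: K_def)
        finally show ?thesis .
      qed
      ultimately have large: "large n" using False n0[of n] by fastforce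
      \<comment> \<open>\<open>F\<close> may be any subfamily of \<open>A\<close>; thus a spread
        part of \<open>A0\<close> also puts its \<open>X\<close> into \<open>S\<close>, which bounds
        \<open>A0\<close>.\<close>
      define core where "core X F \<longleftrightarrow> F \<subseteq> A \<and> (\<forall>\<sigma>\<in>F. X \<subseteq> pairs n \<sigma>) \<and> card X \<le> 30
          \<and> spread (real n powr (4 / 5)) F (\<lambda>\<sigma>. pairs n \<sigma> - X) \<and> fact n \<le> card F * n ^ 33" for X F
      define S where "S = {X. \<exists>F. core X F}"
      define A0 where "A0 = {\<sigma>\<in>A. \<forall>X\<in>S. \<not> X \<subseteq> pairs n \<sigma>}"
      have core_ne: "\<exists>\<sigma>. \<sigma> \<in> F \<and> \<sigma> \<in> A \<and> X \<subseteq> pairs n \<sigma>" if "core X F" for X F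
      proof -
        have "F \<noteq> {}" using that unfolding core_def
          by (metis card.empty fact_nonzero le_zero_eq mult_0)
        then show ?thesis using that unfolding core_def by blast
      qed
      have A0: "card A0 \<le> fact (n - 3)"
      proof (rule ccontr)
        assume "\<not> ?thesis"
        then have "fact (n - 3) < card A0" by simp
        moreover have "A0 \<subseteq> Sym n" using A by (auto simp: A0_def)
        ultimately obtain X where X: "card X \<le> 30"
            "spread (real n powr (4 / 5)) {\<sigma>\<in>A0. X \<subseteq> pairs n \<sigma>} (\<lambda>\<sigma>. pairs n \<sigma> - X)"
            "fact n \<le> card {\<sigma>\<in>A0. X \<subseteq> pairs n \<sigma>} * n ^ 33"
          using exists_spread_part[OF large, of A0] by blast
        then have *: "core X {\<sigma>\<in>A0. X \<subseteq> pairs n \<sigma>}" by (auto simp: core_def A0_def)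
        then have "X \<in> S" unfolding S_def by blast
        then show False using core_ne[OF *] unfolding A0_def by blast
      qed
      have two: "2 \<le> card (X \<inter> Y)" if "X \<in> S" "Y \<in> S" for X Y
      proof (rule ccontr)
        assume "\<not> ?thesis"
        then have "card (X \<inter> Y) \<le> 1" by simp
        obtain F G where FG: "core X F" "core Y G" using \<open>X \<in> S\<close> \<open>Y \<in> S\<close> by (auto simp: S_def)
        have "\<exists>\<sigma>\<in>F. \<exists>\<tau>\<in>G. card (pairs n \<sigma> \<inter> pairs n \<tau>) = 1"
          by (rule exists_single_agreement[OF large, of F X G Y])
            (use FG A \<open>card (X \<inter> Y) \<le> 1\<close> in \<open>auto simp: core_def\<close>)
        then obtain \<sigma> \<tau> where st: "\<sigma> \<in> A" "\<tau> \<in> A" "card (pairs n \<sigma> \<inter> pairs n \<tau>) = 1"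
          using FG unfolding core_def by blast
        \<comment> \<open>Equal permutations would agree at all \<open>n \<ge> 3\<close>
          points.\<close>
        moreover have "\<sigma> \<noteq> \<tau>" using st(3) n by auto
        ultimately show False
          using ns unfolding no_singleton_intersection_def card_agreements by blast
      qed
      \<comment> \<open>Applied to \<open>X\<close> and itself, \<open>two\<close> gives positive
        cardinality, and infinite sets have cardinality 0.\<close>
      have finS: "finite X" if "X \<in> S" for X using two[OF that that] by (auto intro: card_ge_0_finite)
      have cover: "\<exists>X\<in>S. X \<subseteq> pairs n \<sigma>" if "\<sigma> \<in> A - A0" for \<sigma> using that by (auto simp: A0_def)
      have "S \<noteq> {}"
      proof
        assume "S = {}"
        then have "A = A0" by (auto simp: A0_def)
        then have "real (card A) \<le> real (fact (n - 3))" using A0 by (metis of_nat_mono)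
        also have "\<dots> \<le> K * fact (n - 3)" by (simp add: K_def)
        finally show False using False by simp
      qed
      then consider (star) p p' where "p \<noteq> p'" "\<forall>X\<in>S. {p, p'} \<subseteq> X"
        | (triples) T where "finite T" "card T \<le> 30 ^ 3" "\<forall>t\<in>T. card t = 3" "\<forall>X\<in>S. \<exists>t\<in>T. t \<subseteq> X"
      proof -
        have "card X \<le> 30" if "X \<in> S" for X using that by (auto simp: S_def core_def)
        from pairwise_two_intersecting[OF \<open>S \<noteq> {}\<close> finS this two] that show ?thesis by blast
      qed
      then show ?thesis
      proof cases
        case star
        obtain i j k l where pp: "p = (i, j)" "p' = (k, l)" by (metis surj_pair)
        obtain X F where "X \<in> S" "core X F" using \<open>S \<noteq> {}\<close> by (auto simp: S_def)
        \<comment> \<open>The two common pairs lie on one permutation, so they are in range and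
          differ in both coordinates.\<close>
        then obtain \<sigma> where s: "\<sigma> \<in> A" "X \<subseteq> pairs n \<sigma>" using core_ne by blast
        then have pairs: "(i, j) \<in> pairs n \<sigma>" "(k, l) \<in> pairs n \<sigma>"
          using star \<open>X \<in> S\<close> pp by auto
        then have "i \<noteq> k" using star(1) by (auto simp: pairs_iff pp)
        moreover have "j \<noteq> l"
          using pairs calculation s(1) A permutes_inj[of \<sigma> "{1..n}"]
          by (auto simp: pairs_iff Sym_def inj_eq)
        moreover have "i \<in> {1..n}" "j \<in> {1..n}" "k \<in> {1..n}" "l \<in> {1..n}"
          using pairs pairs_subset_grid[of \<sigma> n] s(1) A by blast+
        moreover have "real (card (A - fixing A [(i, j), (k, l)])) \<le> K * fact (n - 3)"
        proof -
          \<comment> \<open>A member outside \<open>A0\<close> extends some element of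
            \<open>S\<close> and therefore contains both common pairs.\<close>
          have "A - fixing A [(i, j), (k, l)] \<subseteq> A0"
          proof
            fix \<tau> assume t: "\<tau> \<in> A - fixing A [(i, j), (k, l)]"
            show "\<tau> \<in> A0"
            proof (rule ccontr)
              assume "\<tau> \<notin> A0"
              then obtain Y where "Y \<in> S" "Y \<subseteq> pairs n \<tau>" using cover t by blast
              then have "(i, j) \<in> pairs n \<tau>" "(k, l) \<in> pairs n \<tau>" using star pp by auto
              then show False using t by (auto simp: fixing_def pairs_iff)
            qed
          qed
          then have "card (A - fixing A [(i, j), (k, l)]) \<le> card A0"
            using finA by (intro card_mono) (auto simp: A0_def)
          then have "real (card (A - fixing A [(i, j), (k, l)])) \<le> real (fact (n - 3))"
            using A0 by (intro of_nat_mono) simp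
          also have "\<dots> \<le> K * fact (n - 3)" by (simp add: K_def)
          finally show ?thesis .
        qed
        ultimately show ?thesis by blast
      next
        case triples
        \<comment> \<open>Here all of \<open>A\<close> is small, contradicting the case assumption:
          a member outside \<open>A0\<close> extends an element of \<open>S\<close>, hence one of
          the triples.\<close>
        have "A \<subseteq> A0 \<union> (\<Union>t\<in>T. {\<sigma>\<in>Sym n. t \<subseteq> pairs n \<sigma>})"
        proof
          fix \<sigma> assume "\<sigma> \<in> A"
          show "\<sigma> \<in> A0 \<union> (\<Union>t\<in>T. {\<sigma>\<in>Sym n. t \<subseteq> pairs n \<sigma>})"
          proof (cases "\<sigma> \<in> A0")
            case False
            then obtain X t where "X \<in> S" "X \<subseteq> pairs n \<sigma>" "t \<in> T" "t \<subseteq> X"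
              using cover[of \<sigma>] \<open>\<sigma> \<in> A\<close> triples(4) by blast
            then show ?thesis using \<open>\<sigma> \<in> A\<close> A by blast
          qed simp
        qed
        then have "card A \<le> card (A0 \<union> (\<Union>t\<in>T. {\<sigma>\<in>Sym n. t \<subseteq> pairs n \<sigma>}))"
          using finA finite_Sym triples(1) by (intro card_mono) (auto simp: A0_def)
        also have "\<dots> \<le> card A0 + card (\<Union>t\<in>T. {\<sigma>\<in>Sym n. t \<subseteq> pairs n \<sigma>})" by (rule card_Un_le)
        also have "\<dots> \<le> card A0 + (\<Sum>t\<in>T. card {\<sigma>\<in>Sym n. t \<subseteq> pairs n \<sigma>})"
          using card_UN_le[OF triples(1)] by (intro add_left_mono)
        also have "\<dots> \<le> fact (n - 3) + (\<Sum>t\<in>T. fact (n - 3))"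
          using A0 triples(3) card_Sym_containing[of n] by (intro add_mono sum_mono) metis+
        also have "\<dots> = (1 + card T) * fact (n - 3)" by simp
        also have "\<dots> \<le> 27001 * fact (n - 3)" using triples(2) by (intro mult_right_mono) auto
        finally have "real (card A) \<le> real (27001 * fact (n - 3))" by (rule of_nat_mono)
        also have "\<dots> \<le> K * fact (n - 3)" by (simp add: K_def)
        finally show ?thesis using False by simp
      qed
    qed
  qed
  moreover have "K > 0" by (simp add: K_def add_nonneg_pos)
  ultimately show ?thesis by blast
qed

end
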